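(* Let $d\ge2$, $1<p\le\infty$ and $0<q\le\infty$. If $B^0_{p,q}(\mathbb{R}^d)\hookrightarrow S^0_{p,q}B(\mathbb{R}^d)$, then $q\ge\max(p,2)$.
   Context: Isotropic Besov spaces: let $\psi_0\in C_0^\infty(\mathbb{R}^d)$ with $\psi_0(x)=1$ if $\max_i|x_i|\le1$ and $\psi_0(x)=0$ if $\max_i|x_i|\ge 3/2$, and $\psi_j(x)=\psi_0(2^{-j}x)-\psi_0(2^{-j+1}x)$, $j\in\mathbb{N}$. For $s\in\mathbb{R}$, $0<p,q\le\infty$, $B^s_{p,q}(\mathbb{R}^d)$ is the set of tempered distributions $f$ with $\big(\sum_{j\ge0}2^{jsq}\|\mathcal{F}^{-1}[\psi_j\mathcal{F}f]\|_{L_p}^q\big)^{1/q}<\infty$ (modification if $q=\infty$), $\mathcal{F}$ the Fourier transform. Dominating mixed spaces: let $\varphi_0\in C_0^\infty(\mathbb{R})$ with $\varphi_0=1$ on $[-1,1]$, $\operatorname{supp}\varphi_0\subset[-3/2,3/2]$, $\varphi_j(s)=\varphi_0(2^{-j}s)-\varphi_0(2^{-j+1}s)$, and $\varphi_{\bar k}(x)=\prod_{i=1}^d\varphi_{k_i}(x_i)$, $|\bar k|=k_1+\dots+k_d$. $S^s_{p,q}B(\mathbb{R}^d)$ is the set of tempered distributions $f$ with $\big(\sum_{\bar k\in\mathbb{N}_0^d}2^{|\bar k|sq}\|\mathcal{F}^{-1}[\varphi_{\bar k}\mathcal{F}f]\|_{L_p}^q\big)^{1/q}<\infty$. $\hookrightarrow$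 is a continuous embedding. *)

theory Defs
  imports "HOL-Analysis.Analysis"
begin

definition pderiv_dir :: "'a::euclidean_space \<Rightarrow> ('a \<Rightarrow> complex) \<Rightarrow> 'a \<Rightarrow> complex" where
  "pderiv_dir i f x = vector_derivative (\<lambda>t::real. f (x + t *\<^sub>R i)) (at 0)"

(* iterated partial derivative along a list of basis directions (a multi-index) *)
definition Dmulti :: "'a::euclidean_space list \<Rightarrow> ('a \<Rightarrow> complex) \<Rightarrow> 'a \<Rightarrow> complex" where
  "Dmulti al f = foldr pderiv_dir al f"

(* Schwartz space: all partial derivatives of all orders exist everywhere and
   are rapidly decreasing (this implies C^\<infinity>) *)
definition schwartz :: "('a::euclidean_space \<Rightarrow> complex) \<Rightarrow> bool" where
  "schwartz f \<longleftrightarrow>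
     (\<forall>al. set al \<subseteq> Basis \<longrightarrow>
        (\<forall>i\<in>Basis. \<forall>x. (\<lambda>t::real. Dmulti al f (x + t *\<^sub>R i)) differentiable (at 0)) \<and>
        (\<forall>N::nat. bounded (range (\<lambda>x. (1 + norm x) ^ N * cmod (Dmulti al f x)))))"

(* C_0^\<infinity>: smooth with compact support (equivalently: Schwartz with bounded support) *)
definition C0inf :: "('a::euclidean_space \<Rightarrow> real) \<Rightarrow> bool" where
  "C0inf f \<longleftrightarrow> schwartz (\<lambda>x. complex_of_real (f x)) \<and> bounded {x. f x \<noteq> 0}"

definition schwartz_seminorm :: "nat \<Rightarrow> nat \<Rightarrow> ('a::euclidean_space \<Rightarrow> complex) \<Rightarrow> real" where
  "schwartz_seminorm k N f =
     Sup {(1 + norm x) ^ N * cmod (Dmulti al f x) | x al. set al \<subseteq> Basis \<and> length al \<le> k}"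

(* a tempered distribution is represented by its action on Schwartz functions
   (values on non-Schwartz arguments are irrelevant) *)
definition tempered :: "(('a::euclidean_space \<Rightarrow> complex) \<Rightarrow> complex) \<Rightarrow> bool" where
  "tempered T \<longleftrightarrow>
     (\<forall>f g. schwartz f \<longrightarrow> schwartz g \<longrightarrow> T (\<lambda>x. f x + g x) = T f + T g) \<and>
     (\<forall>c f. schwartz f \<longrightarrow> T (\<lambda>x. c * f x) = c * T f) \<and>
     (\<exists>C k N. \<forall>f. schwartz f \<longrightarrow> cmod (T f) \<le> C * schwartz_seminorm k N f)"

definition FT :: "('a::euclidean_space \<Rightarrow> complex) \<Rightarrow> 'a \<Rightarrow> complex" where
  "FT f \<xi> = (\<integral>x. exp (- \<i> * complex_of_real (x \<bullet> \<xi>)) * f x \<partial>lborel)"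

definition IFT :: "('a::euclidean_space \<Rightarrow> complex) \<Rightarrow> 'a \<Rightarrow> complex" where
  "IFT g x = complex_of_real (1 / (2 * pi) ^ DIM('a)) *
             (\<integral>\<xi>. exp (\<i> * complex_of_real (x \<bullet> \<xi>)) * g \<xi> \<partial>lborel)"

(* Fourier multiplier on tempered distributions: F^{-1}[m F T],
   <F^{-1}[m F T], \<phi>> = <T, F(m F^{-1} \<phi>)> *)
definition fmult :: "('a::euclidean_space \<Rightarrow> real) \<Rightarrow> (('a \<Rightarrow> complex) \<Rightarrow> complex)
                     \<Rightarrow> ('a \<Rightarrow> complex) \<Rightarrow> complex" where
  "fmult m T = (\<lambda>\<phi>. T (FT (\<lambda>\<xi>. complex_of_real (m \<xi>) * IFT \<phi> \<xi>)))"

definition ennpow :: "ennreal \<Rightarrow> real \<Rightarrow> ennreal" where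
  "ennpow a r = (if a = top then top else ennreal (enn2real a powr r))"

definition Lp_norm :: "ennreal \<Rightarrow> ('a::euclidean_space \<Rightarrow> complex) \<Rightarrow> ennreal" where
  "Lp_norm p g =
     (if p = top then Inf {C. AE x in lborel. ennreal (cmod (g x)) \<le> C}
      else ennpow (\<integral>\<^sup>+ x. ennreal (cmod (g x) powr enn2real p) \<partial>lborel) (1 / enn2real p))"

(* L_p quasi-norm of a distribution: \<infinity> unless it is (represented by) a function *)
definition Lp_dist :: "ennreal \<Rightarrow> (('a::euclidean_space \<Rightarrow> complex) \<Rightarrow> complex) \<Rightarrow> ennreal" where
  "Lp_dist p S = Inf {Lp_norm p g | g. g \<in> borel_measurable lborel \<and>
      (\<forall>\<phi>. schwartz \<phi> \<longrightarrow> integrable lborel (\<lambda>x. g x * \<phi> x) \<and>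
            S \<phi> = (\<integral>x. g x * \<phi> x \<partial>lborel))}"

definition lq_norm :: "ennreal \<Rightarrow> ('i \<Rightarrow> ennreal) \<Rightarrow> ennreal" where
  "lq_norm q a =
     (if q = top then (SUP i. a i)
      else ennpow (\<integral>\<^sup>+ i. ennpow (a i) (enn2real q) \<partial>count_space UNIV) (1 / enn2real q))"

definition dyadic_iso :: "((real^'n::finite) \<Rightarrow> real) \<Rightarrow> nat \<Rightarrow> (real^'n) \<Rightarrow> real" where
  "dyadic_iso \<psi>0 j x = (if j = 0 then \<psi>0 x
     else \<psi>0 ((1 / 2 ^ j) *\<^sub>R x) - \<psi>0 ((1 / 2 ^ (j - 1)) *\<^sub>R x))"

definition besov_norm :: "((real^'n::finite) \<Rightarrow> real) \<Rightarrow> real \<Rightarrow> ennreal \<Rightarrow> ennreal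
                          \<Rightarrow> (((real^'n) \<Rightarrow> complex) \<Rightarrow> complex) \<Rightarrow> ennreal" where
  "besov_norm \<psi>0 s p q T =
     lq_norm q (\<lambda>j::nat. ennreal (2 powr (s * real j)) * Lp_dist p (fmult (dyadic_iso \<psi>0 j) T))"

definition besov_space :: "((real^'n::finite) \<Rightarrow> real) \<Rightarrow> real \<Rightarrow> ennreal \<Rightarrow> ennreal
                           \<Rightarrow> (((real^'n) \<Rightarrow> complex) \<Rightarrow> complex) set" where
  "besov_space \<psi>0 s p q = {T. tempered T \<and> besov_norm \<psi>0 s p q T < top}"

definition dyadic_1d :: "(real \<Rightarrow> real) \<Rightarrow> nat \<Rightarrow> real \<Rightarrow> real" where
  "dyadic_1d \<phi>0 j t = (if j = 0 then \<phi>0 t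
     else \<phi>0 (t / 2 ^ j) - \<phi>0 (t / 2 ^ (j - 1)))"

definition dyadic_mixed :: "(real \<Rightarrow> real) \<Rightarrow> ('n::finite \<Rightarrow> nat) \<Rightarrow> (real^'n) \<Rightarrow> real" where
  "dyadic_mixed \<phi>0 k x = (\<Prod>i\<in>UNIV. dyadic_1d \<phi>0 (k i) (x $ i))"

definition mixed_norm :: "(real \<Rightarrow> real) \<Rightarrow> real \<Rightarrow> ennreal \<Rightarrow> ennreal
                          \<Rightarrow> (((real^'n::finite) \<Rightarrow> complex) \<Rightarrow> complex) \<Rightarrow> ennreal" where
  "mixed_norm \<phi>0 s p q T =
     lq_norm q (\<lambda>k::'n \<Rightarrow> nat. ennreal (2 powr (s * real (\<Sum>i\<in>UNIV. k i)))
                  * Lp_dist p (fmult (dyadic_mixed \<phi>0 k) T))"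

definition mixed_space :: "(real \<Rightarrow> real) \<Rightarrow> real \<Rightarrow> ennreal \<Rightarrow> ennreal
                           \<Rightarrow> (((real^'n::finite) \<Rightarrow> complex) \<Rightarrow> complex) set" where
  "mixed_space \<phi>0 s p q = {T. tempered T \<and> mixed_norm \<phi>0 s p q T < top}"

definition embeds :: "((real^'n::finite) \<Rightarrow> real) \<Rightarrow> (real \<Rightarrow> real) \<Rightarrow> real \<Rightarrow> ennreal \<Rightarrow> ennreal \<Rightarrow> bool" where
  "embeds \<psi>0 \<phi>0 s p q \<longleftrightarrow>
     besov_space \<psi>0 s p q \<subseteq> (mixed_space \<phi>0 s p q :: (((real^'n) \<Rightarrow> complex) \<Rightarrow> complex) set) \<and>
     (\<exists>C::real. \<forall>T\<in>besov_space \<psi>0 s p q.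
        mixed_norm \<phi>0 s p q T \<le> ennreal C * besov_norm \<psi>0 s p q T)"

end

theory Submission
  imports Defs "HOL-Probability.Sinc_Integral"
begin

text \<open>
  Test the embedding on sums of \<open>N\<close> wave packets \<open>e\<^sub>k exp (i x \<bullet> w\<^sub>k) F (x - a\<^sub>k)\<close> with unimodular
  \<open>e\<^sub>k\<close>, where \<open>F\<close> is a tensor product of Fejer kernels \<open>(1 - cos t) / t\<^sup>2\<close>, so that its Fourier
  transform lives in the unit cube, and where \<open>w\<^sub>k\<close> is \<open>7/8 2\<^sup>J\<close> in one coordinate, \<open>7/8 2\<^sup>k\<close> in
  another and zero elsewhere. All packets lie in a single isotropic dyadic block, so the Besov
  norm of the sum is at most its \<open>L\<^sub>p\<close> norm, but they lie in \<open>N\<close> different mixed blocks, so the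
  mixed norm is at least a constant times \<open>N\<^bsup>1/q\<^esup>\<close>. Translating the packets apart makes the
  \<open>L\<^sub>p\<close> norm of order \<open>N\<^bsup>1/p\<^esup>\<close>, which forces \<open>q \<ge> p\<close>. For \<open>p < 2\<close>, packets at the origin with
  well chosen signs have \<open>L\<^sub>p\<close> norm of order \<open>N\<^bsup>1/2\<^esup>\<close>, which forces \<open>q \<ge> 2\<close>.
\<close>

subsection \<open>Integration on Euclidean space\<close>

text \<open>The Fejer profile is chosen because both of its transforms are elementary integrals:
  \<open>fejer\<close> goes to a multiple of \<open>tri\<close>, and \<open>tri\<close> back to
  \<open>2 * fejer\<close>. Fourier inversion for the packets is thus an explicit computation, with
  absolutely integrable functions on both sides although neither is a Schwartz function. The compact
  support of \<open>tri\<close> makes each dyadic multiplier act on a packet as exactly 0 or 1,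
  without error terms. The lower bound has to cope with \<open>Lp_dist\<close> being an infimum over
  all functions that represent a distribution. Instead of identifying these representatives, the
  proof pairs each of them with a modulated Gaussian: the pairing depends only on the distribution,
  and its modulus is the same positive number for every packet. For \<open>p \<ge> 2\<close> the
  condition \<open>q \<ge> p\<close> already contains \<open>q \<ge> 2\<close>, so signs enter only
  for \<open>p < 2\<close>. They come from the parallelogram law, which plays the role of the
  averaging in Khinchine's inequality. Both parts end by comparing exponents of \<open>N\<close> as
  \<open>N\<close> grows.\<close>

lemma
  fixes f :: "'a::euclidean_space \<Rightarrow> real \<Rightarrow> complex"
  assumes f: "\<And>b. b \<in> Basis \<Longrightarrow> integrable lborel (f b)"
  shows integrable_lborel_prod: "integrable lborel (\<lambda>x. \<Prod>b\<in>Basis. f b (x \<bullet> b))"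
    and integral_lborel_prod:
      "(\<integral>x. (\<Prod>b\<in>Basis. f b (x \<bullet> b)) \<partial>lborel) = (\<Prod>b\<in>Basis. \<integral>t. f b t \<partial>lborel)"
proof -
  interpret product_sigma_finite "\<lambda>_::'a. lborel :: real measure" ..
  have [measurable]: "\<And>b. b \<in> Basis \<Longrightarrow> f b \<in> borel_measurable borel"
    using borel_measurable_integrable[OF f] by simp
  show "integrable lborel (\<lambda>x. \<Prod>b\<in>Basis. f b (x \<bullet> b))"
    unfolding lborel_def
    by (subst integrable_distr_eq) (auto simp: lborel_eq_real[symmetric] intro!: product_integrable_prod f)
  show "(\<integral>x. (\<Prod>b\<in>Basis. f b (x \<bullet> b)) \<partial>lborel) = (\<Prod>b\<in>Basis. \<integral>t. f b t \<partial>lborel)"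
    by (subst lborel_def, subst integral_distr)
       (auto simp: lborel_eq_real[symmetric] intro!: product_integral_prod f)
qed

lemma prod_Basis_vec:
  fixes g :: "'n::finite \<Rightarrow> 'c \<Rightarrow> 'b::comm_monoid_mult" and h :: "real^'n \<Rightarrow> 'c"
  shows "(\<Prod>b\<in>Basis. g (axis_index b) (h b)) = (\<Prod>i\<in>UNIV. g i (h (axis i 1)))"
proof -
  have "(Basis :: (real^'n) set) = (\<lambda>i. axis i 1) ` UNIV"
    by (auto simp: Basis_vec_def)
  moreover have "inj (\<lambda>i::'n. axis i (1::real))"
    by (auto simp: inj_on_def axis_eq_axis)
  ultimately show ?thesis
    by (metis (mono_tags, lifting) prod.reindex_cong axis_index_axis)
qed

lemma
  fixes u :: "'n::finite \<Rightarrow> real \<Rightarrow> complex"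
  assumes u: "\<And>i. integrable lborel (u i)"
  shows integrable_lborel_vec_prod: "integrable lborel (\<lambda>x::real^'n. \<Prod>i\<in>UNIV. u i (x $ i))"
    and integral_lborel_vec_prod:
      "(\<integral>x. (\<Prod>i\<in>UNIV. u i (x $ i)) \<partial>(lborel :: (real^'n) measure)) = (\<Prod>i\<in>UNIV. \<integral>t. u i t \<partial>lborel)"
proof -
  have *: "(\<Prod>b\<in>Basis. u (axis_index b) (x \<bullet> b)) = (\<Prod>i\<in>UNIV. u i (x $ i))" for x :: "real^'n"
    by (subst prod_Basis_vec) (simp add: inner_axis)
  show "integrable lborel (\<lambda>x::real^'n. \<Prod>i\<in>UNIV. u i (x $ i))"
    using integrable_lborel_prod[where f="\<lambda>b::real^'n. u (axis_index b)"] u by (simp add: *)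
  show "(\<integral>x. (\<Prod>i\<in>UNIV. u i (x $ i)) \<partial>(lborel :: (real^'n) measure)) = (\<Prod>i\<in>UNIV. \<integral>t. u i t \<partial>lborel)"
    using integral_lborel_prod[where f="\<lambda>b::real^'n. u (axis_index b)"] u
      prod_Basis_vec[of "\<lambda>i _. \<integral>t. u i t \<partial>lborel" "\<lambda>b. b"] by (simp add: *)
qed

lemma integrable_lborel_pair_mult:
  fixes f :: "'a::euclidean_space \<Rightarrow> complex" and g :: "'b::euclidean_space \<Rightarrow> complex"
  assumes "integrable lborel f" "integrable lborel g"
  shows "integrable (lborel \<Otimes>\<^sub>M lborel) (\<lambda>(x, y). f x * g y)"
proof -
  have [measurable]: "f \<in> borel_measurable borel" "g \<in> borel_measurable borel"
    using assms[THEN borel_measurable_integrable] by auto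
  show ?thesis
    by (rule lborel_pair.Fubini_integrable) (use assms in \<open>auto simp: norm_mult\<close>)
qed

text \<open>A kernel of modulus at most 1 leaves \<open>f x * g y\<close> as an integrable majorant
  on the product space, so the order of integration may be exchanged. For exponential kernels this
  is the rule that moves a Fourier transform from one factor to the other.\<close>

lemma Fubini_bounded_kernel:
  fixes f :: "'a::euclidean_space \<Rightarrow> complex" and g :: "'b::euclidean_space \<Rightarrow> complex"
    and K :: "'a \<Rightarrow> 'b \<Rightarrow> complex"
  assumes f: "integrable lborel f" and g: "integrable lborel g"
    and K [measurable]: "case_prod K \<in> borel_measurable (borel \<Otimes>\<^sub>M borel)" and K1: "\<And>x y. cmod (K x y) \<le> 1"
  shows "(\<integral>x. f x * (\<integral>y. K x y * g y \<partial>lborel) \<partial>lborel) = (\<integral>y. (\<integral>x. K x y * f x \<partial>lborel) * g y \<partial>lborel)"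
proof -
  have [measurable]: "f \<in> borel_measurable borel" "g \<in> borel_measurable borel"
    using f g by (auto dest!: borel_measurable_integrable)
  have "integrable (lborel \<Otimes>\<^sub>M lborel) (\<lambda>(x, y). K x y * f x * g y)"
    by (rule Bochner_Integration.integrable_bound[OF integrable_lborel_pair_mult[OF f g]])
       (auto simp: norm_mult mult.assoc intro!: AE_I2 mult_left_le_one_le K1)
  from lborel_pair.Fubini_integral[OF this] show ?thesis
    by (simp add: mult.assoc mult.left_commute[of "f _"] mult.left_commute[of "g _"]
      flip: integral_mult_right_zero integral_mult_left_zero)
qed

lemma integral_lborel_translate:
  fixes f :: "'a::euclidean_space \<Rightarrow> 'b::{banach, second_countable_topology}"
  assumes "integrable lborel f"
  shows "integrable lborel (\<lambda>x. f (x - a))" "(\<integral>x. f (x - a) \<partial>lborel) = (\<integral>x. f x \<partial>lborel)"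
proof -
  have [measurable]: "f \<in> borel_measurable borel"
    using assms by (auto dest!: borel_measurable_integrable)
  have D: "distr lborel borel (\<lambda>x. x - a) = lborel"
    by (metis lborel_distr_plus[of "-a"] diff_conv_add_uminus add.commute ext)
  have "integrable (distr lborel borel (\<lambda>x. x - a)) f" using assms by (simp add: D)
  then show "integrable lborel (\<lambda>x. f (x - a))" by (simp add: integrable_distr_eq)
  have "integral\<^sup>L (distr lborel borel (\<lambda>x. x - a)) f = (\<integral>x. f (x - a) \<partial>lborel)"
    by (subst integral_distr) auto
  then show "(\<integral>x. f (x - a) \<partial>lborel) = (\<integral>x. f x \<partial>lborel)" by (simp add: D)
qed

subsection \<open>Schwartz functions\<close>

lemma Dmulti_Nil [simp]: "Dmulti [] f = f"
  and Dmulti_Cons [simp]: "Dmulti (i # al) f = pderiv_dir i (Dmulti al f)"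
  by (simp_all add: Dmulti_def)

lemma schwartz_decay:
  assumes "schwartz f"
  obtains C where "C \<ge> 0" "\<And>x. (1 + norm x) ^ N * cmod (f x) \<le> C"
proof -
  have "bounded (range (\<lambda>x. (1 + norm x) ^ N * cmod (f x)))"
    using assms unfolding schwartz_def by (metis Dmulti_Nil empty_set empty_subsetI)
  then obtain C where "\<forall>x. norm ((1 + norm x) ^ N * cmod (f x)) \<le> C"
    unfolding bounded_iff by auto
  then show thesis
    by (intro that[of "max 0 C"]) (auto simp: abs_mult le_max_iff_disj)
qed

text \<open>\<open>schwartz\<close> speaks only of derivatives along single axes, so continuity is
  not immediate. The first-order ones are bounded; the mean value inequality gives a Lipschitz bound
  along each axis, and changing one coordinate at a time adds these up to a global Lipschitz
  bound.\<close>

lemma schwartz_continuous: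
  fixes f :: "'a::euclidean_space \<Rightarrow> complex"
  assumes f: "schwartz f"
  shows "continuous_on UNIV f"
proof -
  have "\<exists>C\<ge>0. \<forall>i\<in>Basis. \<forall>x. cmod (pderiv_dir i f x) \<le> C"
  proof -
    have "\<forall>i\<in>Basis. \<exists>C\<ge>0. \<forall>x. cmod (pderiv_dir i f x) \<le> C"
    proof
      fix i :: 'a assume "i \<in> Basis"
      then have "set [i] \<subseteq> Basis" by simp
      then have "bounded (range (\<lambda>x. (1 + norm x) ^ 0 * cmod (Dmulti [i] f x)))"
        using f unfolding schwartz_def by blast
      then obtain B where "\<And>x. cmod (pderiv_dir i f x) \<le> B"
        unfolding bounded_iff by auto
      then show "\<exists>C\<ge>0. \<forall>x. cmod (pderiv_dir i f x) \<le> C"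
        by (intro exI[of _ "max 0 B"]) (simp add: le_max_iff_disj)
    qed
    then obtain C where C: "\<And>i. i \<in> Basis \<Longrightarrow> C i \<ge> 0 \<and> (\<forall>x. cmod (pderiv_dir i f x) \<le> C i)"
      by metis
    then show ?thesis
      by (intro exI[of _ "sum C Basis"])
         (auto intro!: sum_nonneg order_trans[OF _ member_le_sum[of _ Basis C]])
  qed
  then obtain C where C0: "C \<ge> 0" and C: "\<And>i x. i \<in> Basis \<Longrightarrow> cmod (pderiv_dir i f x) \<le> C"
    by blast
  have line: "cmod (f (x + t *\<^sub>R i) - f x) \<le> C * \<bar>t\<bar>" if i: "i \<in> Basis" for x i and t :: real
  proof -
    \<comment> \<open>The definition provides derivatives only at parameter 0; the derivative at
      \<open>s\<close> is the one at 0 taken from the shifted base point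
      \<open>x + s *\<^sub>R i\<close>.\<close>
    have "((\<lambda>t. f (x + t *\<^sub>R i)) has_vector_derivative pderiv_dir i f (x + s *\<^sub>R i)) (at s)" for s
    proof -
      have "(\<lambda>t::real. Dmulti [] f ((x + s *\<^sub>R i) + t *\<^sub>R i)) differentiable (at 0)"
        using f i unfolding schwartz_def by (metis empty_set empty_subsetI)
      then have "((\<lambda>t::real. f ((x + s *\<^sub>R i) + t *\<^sub>R i)) has_vector_derivative pderiv_dir i f (x + s *\<^sub>R i)) (at 0)"
        unfolding pderiv_dir_def by (simp add: vector_derivative_works)
      then have "(((\<lambda>t::real. f ((x + s *\<^sub>R i) + t *\<^sub>R i)) \<circ> (\<lambda>t. t - s)) has_vector_derivative (1 *\<^sub>R pderiv_dir i f (x + s *\<^sub>R i))) (at s)"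
        by (intro vector_diff_chain_at) (auto intro!: derivative_eq_intros)
      then show ?thesis by (simp add: o_def algebra_simps)
    qed
    then have "norm (f (x + t *\<^sub>R i) - f (x + 0 *\<^sub>R i)) \<le> C * norm (t - 0)"
    proof (intro differentiable_bound[where S=UNIV and f'="\<lambda>s h. h *\<^sub>R pderiv_dir i f (x + s *\<^sub>R i)"])
      show "onorm (\<lambda>h. h *\<^sub>R pderiv_dir i f (x + s *\<^sub>R i)) \<le> C" for s
        using C[OF i, of "x + s *\<^sub>R i"] mult_left_mono[of _ C]
        by (intro onorm_le) (simp add: mult.commute[of C])
    qed (auto simp: has_vector_derivative_def)
    then show ?thesis by simp
  qed
  have diff: "cmod (f (x + (\<Sum>i\<in>B. c i *\<^sub>R i)) - f x) \<le> C * (\<Sum>i\<in>B. \<bar>c i\<bar>)" if "B \<subseteq> Basis" for B x c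
    using finite_subset[OF that finite_Basis] that
  proof (induction B)
    case (insert i B)
    have "cmod (f (x + (\<Sum>i\<in>B. c i *\<^sub>R i) + c i *\<^sub>R i) - f (x + (\<Sum>i\<in>B. c i *\<^sub>R i))) \<le> C * \<bar>c i\<bar>"
      using insert by (intro line) auto
    with insert have "cmod (f (x + (\<Sum>i\<in>B. c i *\<^sub>R i) + c i *\<^sub>R i) - f (x + (\<Sum>i\<in>B. c i *\<^sub>R i)) + (f (x + (\<Sum>i\<in>B. c i *\<^sub>R i)) - f x)) \<le> C * \<bar>c i\<bar> + C * (\<Sum>i\<in>B. \<bar>c i\<bar>)"
      by (intro norm_triangle_mono) auto
    with insert show ?case by (simp add: algebra_simps)
  qed simp
  have lip: "dist (f y) (f x) \<le> C * DIM('a) * dist y x" for x y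
  proof -
    have "y = x + (\<Sum>i\<in>Basis. ((y - x) \<bullet> i) *\<^sub>R i)"
      by (simp add: euclidean_representation)
    then have "cmod (f y - f x) \<le> C * (\<Sum>i\<in>Basis. \<bar>(y - x) \<bullet> i\<bar>)"
      using diff[of Basis x "\<lambda>i. (y - x) \<bullet> i"] by simp
    also have "\<dots> \<le> C * (\<Sum>i\<in>(Basis::'a set). norm (y - x))"
      using C0 by (intro mult_left_mono sum_mono Basis_le_norm) auto
    finally show ?thesis by (simp add: dist_norm mult.assoc)
  qed
  have "(C * DIM('a))-lipschitz_on UNIV f"
    using lip C0 by (intro lipschitz_onI) auto
  then show ?thesis by (rule lipschitz_on_continuous_on)
qed

lemma integrable_inverse_1_plus_square_lborel: "integrable lborel (\<lambda>x::real. inverse (1 + x^2))"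
  using integrable_inverse_1_plus_square by (simp add: set_integrable_def einterval_def)

text \<open>The decay exponent \<open>2 * DIM('a)\<close> suffices to dominate the product of
  \<open>1 + (x \<bullet> b)\<^sup>2\<close> over all coordinates, each factor being at most
  \<open>(1 + norm x)\<^sup>2\<close>. The resulting majorant is a tensor product of integrable
  functions of one variable.\<close>

lemma schwartz_integrable:
  fixes f :: "'a::euclidean_space \<Rightarrow> complex"
  assumes f: "schwartz f"
  shows "integrable lborel f"
proof -
  have [measurable]: "f \<in> borel_measurable borel"
    using schwartz_continuous[OF f] by (simp add: borel_measurable_continuous_onI)
  obtain C where "C \<ge> 0" and C: "\<And>x. (1 + norm x) ^ (2 * DIM('a)) * cmod (f x) \<le> C"
    using schwartz_decay[OF f] by blast
  have int: "integrable lborel (\<lambda>x::'a. complex_of_real (C * (\<Prod>b\<in>Basis. inverse (1 + (x \<bullet> b)^2))))"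
    unfolding of_real_mult of_real_prod
    by (intro integrable_mult_right integrable_lborel_prod[where f="\<lambda>b t. complex_of_real (inverse (1 + t^2))"]
        integrable_of_real integrable_inverse_1_plus_square_lborel)
  show ?thesis
  proof (rule Bochner_Integration.integrable_bound[OF int], simp, intro AE_I2)
    fix x :: 'a
    have "(\<Prod>b\<in>(Basis::'a set). 1 + (x \<bullet> b)^2) \<le> (\<Prod>b\<in>(Basis::'a set). (1 + norm x)^2)"
    proof (intro prod_mono conjI)
      fix b :: 'a assume "b \<in> Basis"
      then have "\<bar>x \<bullet> b\<bar> \<le> norm x" by (rule Basis_le_norm)
      then have "(x \<bullet> b)^2 \<le> (norm x)^2" by (metis abs_ge_zero power2_abs power_mono)
      then show "1 + (x \<bullet> b)^2 \<le> (1 + norm x)^2"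
        using mult_nonneg_nonneg[OF zero_le_numeral norm_ge_zero, of num.One x]
        by (simp add: power2_sum add_increasing2)
    qed (auto intro: add_nonneg_nonneg)
    also have "\<dots> = (1 + norm x) ^ (2 * DIM('a))" by (simp add: power_mult)
    finally have "(\<Prod>b\<in>(Basis::'a set). 1 + (x \<bullet> b)^2) * cmod (f x) \<le> C"
      using C[of x] by (meson mult_right_mono norm_ge_zero order_trans)
    moreover have "(\<Prod>b\<in>(Basis::'a set). 1 + (x \<bullet> b)^2) > 0"
      by (intro prod_pos) (auto intro: add_pos_nonneg)
    ultimately have "cmod (f x) \<le> C * inverse (\<Prod>b\<in>(Basis::'a set). 1 + (x \<bullet> b)^2)"
      by (simp add: field_simps)
    also have "\<dots> = C * (\<Prod>b\<in>(Basis::'a set). inverse (1 + (x \<bullet> b)^2))"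
      using prod_inversef[of "\<lambda>b. 1 + (x \<bullet> b)^2" "Basis :: 'a set"] by (simp add: o_def)
    also have "\<dots> \<le> norm (complex_of_real (C * (\<Prod>b\<in>(Basis::'a set). inverse (1 + (x \<bullet> b)^2))))"
      unfolding norm_of_real by (rule abs_ge_self)
    finally show "cmod (f x) \<le> norm (complex_of_real (C * (\<Prod>b\<in>Basis. inverse (1 + (x \<bullet> b)^2))))" .
  qed
qed

subsection \<open>The Fejer kernel\<close>

text \<open>The value at 0 is the continuous extension, so that \<open>integral_tri_cos\<close>
  holds for every \<open>t\<close>, including 0.\<close>

definition fejer :: "real \<Rightarrow> real" where
  "fejer t = (if t = 0 then 1 / 2 else (1 - cos t) / t\<^sup>2)"

definition tri :: "real \<Rightarrow> real" where
  "tri \<xi> = max 0 (1 - \<bar>\<xi>\<bar>)"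

lemma fejer_minus [simp]: "fejer (- t) = fejer t"
  and tri_minus [simp]: "tri (- t) = tri t"
  by (simp_all add: fejer_def tri_def)

lemma fejer_nonneg: "0 \<le> fejer t"
  by (simp add: fejer_def)

lemma fejer_le_half: "fejer t \<le> 1 / 2"
proof -
  have "(sin (t/2))\<^sup>2 \<le> (t/2)\<^sup>2"
    using abs_sin_x_le_abs_x[of "t/2"] by (simp only: abs_le_square_iff)
  moreover have "cos t = 1 - 2 * (sin (t/2))\<^sup>2"
    using cos_double_sin[of "t/2"] by simp
  ultimately have "1 - cos t \<le> t\<^sup>2 / 2" by (simp add: power_divide)
  then show ?thesis by (simp add: fejer_def divide_le_eq)
qed

lemma fejer_le: "fejer t \<le> 4 * inverse (1 + t\<^sup>2)"
proof (cases "\<bar>t\<bar> \<le> 1")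
  case True
  then have "t\<^sup>2 \<le> 1" by (simp add: abs_square_le_1)
  moreover have "1 + t\<^sup>2 > 0" by (intro add_pos_nonneg) auto
  ultimately have "1 / 2 \<le> 4 * inverse (1 + t\<^sup>2)" by (simp add: field_simps)
  then show ?thesis using fejer_le_half[of t] by linarith
next
  case False
  then have "t\<^sup>2 > 1" by (metis abs_square_le_1 not_le)
  then have "(1 - cos t) / t\<^sup>2 \<le> 2 / t\<^sup>2" using cos_ge_minus_one[of t] by (intro divide_right_mono) auto
  also have "\<dots> \<le> 4 * inverse (1 + t\<^sup>2)" using \<open>t\<^sup>2 > 1\<close> by (simp add: divide_simps)
  finally show ?thesis using False by (auto simp: fejer_def)
qed

lemma fejer_measurable [measurable]: "fejer \<in> borel_measurable borel"
  unfolding fejer_def[abs_def] by measurable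

lemma tri_continuous: "continuous_on S tri"
  unfolding tri_def[abs_def] by (intro continuous_intros)

lemma tri_measurable [measurable]: "tri \<in> borel_measurable borel"
  unfolding tri_def[abs_def] by measurable

lemma fejer_integrable: "integrable lborel fejer"
  by (rule Bochner_Integration.integrable_bound[OF integrable_mult_right[OF integrable_inverse_1_plus_square_lborel, of 4]])
     (auto simp: fejer_nonneg fejer_le)

definition fejer_mass :: real where "fejer_mass = (\<integral>t. fejer t \<partial>lborel)"

text \<open>The window \<open>{1..2}\<close> has length 1, so \<open>\<delta>\<close> itself is a
  lower bound; it also stays away from 0, where \<open>fejer\<close> is defined by cases.\<close>

lemma integral_lborel_pos:
  fixes g :: "real \<Rightarrow> real"
  assumes g: "integrable lborel g" and "\<And>t. 0 \<le> g t" and \<delta>: "0 < \<delta>" "\<And>t. 1 \<le> t \<Longrightarrow> t \<le> 2 \<Longrightarrow> \<delta> \<le> g t"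
  shows "0 < (\<integral>t. g t \<partial>lborel)"
proof -
  have "\<delta> = (\<integral>t. \<delta> * indicator {1..2::real} t \<partial>lborel)" by simp
  also have "\<dots> \<le> (\<integral>t. g t \<partial>lborel)"
    using assms by (intro integral_mono) (auto split: split_indicator)
  finally show ?thesis using \<delta>(1) by linarith
qed

lemma fejer_lower: "1 \<le> t \<Longrightarrow> t \<le> 2 \<Longrightarrow> (1 - cos 1) / 4 \<le> fejer t"
proof -
  assume t: "1 \<le> t" "t \<le> 2"
  have "cos t \<le> cos 1" using t pi_gt3 by (intro cos_monotone_0_pi_le) auto
  moreover have "t\<^sup>2 \<le> 2\<^sup>2" using t by (intro power_mono) auto
  ultimately have "(1 - cos 1) / 4 \<le> (1 - cos t) / t\<^sup>2" using t by (intro frac_le) auto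
  then show ?thesis using t by (simp add: fejer_def)
qed

lemma cos_1_less_1: "cos (1::real) < 1"
  using cos_monotone_0_pi[of 0 1] pi_gt3 by simp

lemma fejer_mass_pos: "fejer_mass > 0"
  unfolding fejer_mass_def using cos_1_less_1 fejer_lower
  by (intro integral_lborel_pos[of _ "(1 - cos 1) / 4"] fejer_integrable fejer_nonneg) auto

text \<open>By scaling, \<open>\<integral> (1 - cos (a t)) / t\<^sup>2 dt\<close> is proportional to \<open>\<bar>a\<bar>\<close>; the value of the
  constant is never needed.\<close>

lemma has_bochner_integral_one_minus_cos:
  "has_bochner_integral lborel (\<lambda>t. (1 - cos (a * t)) / t\<^sup>2) (\<bar>a\<bar> * fejer_mass)"
proof (cases "a = 0")
  case False
  have "has_bochner_integral lborel (\<lambda>t. fejer (0 + a * t)) (fejer_mass /\<^sub>R \<bar>a\<bar>)"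
    using fejer_integrable
    by (subst lborel_has_bochner_integral_real_affine_iff[OF False, symmetric])
       (simp add: has_bochner_integral_iff fejer_mass_def)
  then have "has_bochner_integral lborel (\<lambda>t. a\<^sup>2 * fejer (a * t)) (a\<^sup>2 * (fejer_mass /\<^sub>R \<bar>a\<bar>))"
    by (intro has_bochner_integral_mult_right) auto
  also have "a\<^sup>2 * (fejer_mass /\<^sub>R \<bar>a\<bar>) = \<bar>a\<bar> * fejer_mass"
    using False by (simp add: field_simps power2_eq_square abs_mult_self)
  finally show ?thesis
    by (rule has_bochner_integral_cong_AE[THEN iffD1, rotated -1])
       (use AE_lborel_singleton[of 0] False in \<open>auto simp: fejer_def field_simps elim!: eventually_mono\<close>)
qed (simp add: has_bochner_integral_zero)

text \<open>The product formula for cosines writes \<open>(1 - cos t) * cos (\<xi> * t)\<close> as a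
  second difference of the functions \<open>1 - cos (a * t)\<close> at \<open>a = 1 + \<xi>\<close>,
  \<open>1 - \<xi>\<close> and \<open>\<xi>\<close>. Their integrals against
  \<open>1 / t\<^sup>2\<close> are proportional to \<open>\<bar>a\<bar>\<close>, and the same second
  difference of the absolute value is the triangle \<open>tri\<close>.\<close>

lemma integral_fejer_cos: "(\<integral>t. fejer t * cos (\<xi> * t) \<partial>lborel) = fejer_mass * tri \<xi>"
proof -
  have "has_bochner_integral lborel
      (\<lambda>t. 1/2 * ((1 - cos ((1 + \<xi>) * t)) / t\<^sup>2) + 1/2 * ((1 - cos ((1 - \<xi>) * t)) / t\<^sup>2) - (1 - cos (\<xi> * t)) / t\<^sup>2)
      (1/2 * (\<bar>1 + \<xi>\<bar> * fejer_mass) + 1/2 * (\<bar>1 - \<xi>\<bar> * fejer_mass) - \<bar>\<xi>\<bar> * fejer_mass)" (is "has_bochner_integral _ ?f ?I")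
    by (intro has_bochner_integral_diff has_bochner_integral_add has_bochner_integral_mult_right
        has_bochner_integral_one_minus_cos)
  then have "(\<integral>t. ?f t \<partial>lborel) = ?I" by (rule has_bochner_integral_integral_eq)
  moreover have "(\<integral>t. fejer t * cos (\<xi> * t) \<partial>lborel) = (\<integral>t. ?f t \<partial>lborel)"
  proof (rule integral_cong_AE)
    have "fejer t * cos (\<xi> * t) = ?f t" if "t \<noteq> 0" for t
      using that by (simp add: fejer_def field_simps cos_add cos_diff)
    then show "AE t in lborel. fejer t * cos (\<xi> * t) = ?f t"
      using AE_lborel_singleton[of "0::real"] by (auto elim!: eventually_mono)
  qed auto
  moreover have "?I = fejer_mass * (1/2 * \<bar>1 + \<xi>\<bar> + 1/2 * \<bar>1 - \<xi>\<bar> - \<bar>\<xi>\<bar>)"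
    by (simp add: algebra_simps)
  moreover have "1/2 * \<bar>1 + \<xi>\<bar> + 1/2 * \<bar>1 - \<xi>\<bar> - \<bar>\<xi>\<bar> = tri \<xi>"
    by (auto simp: tri_def max_def abs_if field_simps)
  ultimately show ?thesis by simp
qed

lemma tri_integrable: "integrable lborel tri"
proof -
  have "integrable lborel (\<lambda>t. indicator {-1..1::real} t *\<^sub>R tri t)"
    by (intro borel_integrable_compact tri_continuous) auto
  moreover have "(\<lambda>t. indicator {-1..1::real} t *\<^sub>R tri t) = tri"
    by (auto simp: fun_eq_iff tri_def split: split_indicator)
  ultimately show ?thesis by simp
qed

lemma integral_tri_cos: "(\<integral>\<xi>. tri \<xi> * cos (t * \<xi>) \<partial>lborel) = 2 * fejer t"
proof -
  \<comment> \<open>\<open>g\<close> is the right half of the integrand; its reflection supplies the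
    left half, and the two overlap only at 0. Each half has an elementary antiderivative.\<close>
  define g where "g \<xi> = (1 - \<xi>) * cos (t * \<xi>) * indicator {0..1} \<xi>" for \<xi>
  have g: "has_bochner_integral lborel g (fejer t)"
  proof (cases "t = 0")
    case True
    have "has_bochner_integral lborel (\<lambda>\<xi>. (1 - \<xi>) * indicator {0..1} \<xi>) ((1 - 1\<^sup>2/2) - (0 - 0\<^sup>2/2 :: real))"
      by (rule has_bochner_integral_FTC_Icc_real[where F="\<lambda>\<xi>. \<xi> - \<xi>\<^sup>2/2"]) (auto intro!: derivative_eq_intros)
    then show ?thesis using True by (simp add: g_def[abs_def] fejer_def)
  next
    case False
    have "has_bochner_integral lborel (\<lambda>\<xi>. ((1 - \<xi>) * cos (t * \<xi>)) * indicator {0..1} \<xi>)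
      (((1 - 1) * sin (t * 1) / t - cos (t * 1) / t\<^sup>2) - ((1 - 0) * sin (t * 0) / t - cos (t * 0) / t\<^sup>2))"
      by (rule has_bochner_integral_FTC_Icc_real[where F="\<lambda>\<xi>. (1 - \<xi>) * sin (t * \<xi>) / t - cos (t * \<xi>) / t\<^sup>2"])
         (use False in \<open>auto intro!: derivative_eq_intros simp: field_simps power2_eq_square\<close>)
    then show ?thesis using False by (simp add: g_def[abs_def] fejer_def diff_divide_distrib)
  qed
  have g': "has_bochner_integral lborel (\<lambda>\<xi>. g (0 + (-1) * \<xi>)) (fejer t /\<^sub>R \<bar>-1\<bar>)"
    by (subst lborel_has_bochner_integral_real_affine_iff[symmetric]) (auto simp: g)
  have "(\<integral>\<xi>. tri \<xi> * cos (t * \<xi>) \<partial>lborel) = (\<integral>\<xi>. g \<xi> + g (- \<xi>) \<partial>lborel)"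
  proof (rule integral_cong_AE)
    have "tri \<xi> * cos (t * \<xi>) = g \<xi> + g (- \<xi>)" if "\<xi> \<noteq> 0" for \<xi>
      using that by (auto simp: g_def tri_def split: split_indicator)
    then show "AE \<xi> in lborel. tri \<xi> * cos (t * \<xi>) = g \<xi> + g (- \<xi>)"
      using AE_lborel_singleton[of "0::real"] by (auto elim!: eventually_mono)
  qed (auto simp: g_def)
  also have "\<dots> = fejer t + fejer t"
    using has_bochner_integral_add[OF g g'] by (intro has_bochner_integral_integral_eq) simp
  finally show ?thesis by simp
qed

lemma integral_exp_even:
  fixes g :: "real \<Rightarrow> real"
  assumes g: "integrable lborel g" and even: "\<And>t. g (- t) = g t"
  shows "(\<integral>t. exp (\<i> * complex_of_real (\<xi> * t)) * complex_of_real (g t) \<partial>lborel)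
    = complex_of_real (\<integral>t. g t * cos (\<xi> * t) \<partial>lborel)"
proof -
  have [measurable]: "g \<in> borel_measurable borel" using g by (auto dest!: borel_measurable_integrable)
  have c: "integrable lborel (\<lambda>t. g t * cos (\<xi> * t))"
    by (rule Bochner_Integration.integrable_bound[OF g]) (auto simp: abs_mult intro!: AE_I2 mult_left_le)
  have s: "integrable lborel (\<lambda>t. g t * sin (\<xi> * t))"
    by (rule Bochner_Integration.integrable_bound[OF g]) (auto simp: abs_mult intro!: AE_I2 mult_left_le)
  \<comment> \<open>The sine part is odd, so the substitution of \<open>- t\<close> turns its
    integral into its own negative.\<close>
  have "(\<integral>t. g t * sin (\<xi> * t) \<partial>lborel) = - (\<integral>t. g t * sin (\<xi> * t) \<partial>lborel)"
    using lborel_integral_real_affine[of "-1" "\<lambda>t. g t * sin (\<xi> * t)" 0] by (simp add: even)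
  then have 0: "(\<integral>t. g t * sin (\<xi> * t) \<partial>lborel) = 0" by simp
  have "(\<lambda>t. exp (\<i> * complex_of_real (\<xi> * t)) * complex_of_real (g t))
     = (\<lambda>t. complex_of_real (g t * cos (\<xi> * t)) + \<i> * complex_of_real (g t * sin (\<xi> * t)))"
    by (simp only: cis_conv_exp[symmetric]) (simp add: fun_eq_iff complex_eq_iff)
  then show ?thesis using c s 0
    by (simp add: integral_complex_of_real del: of_real_mult)
qed

lemma integral_exp_fejer:
  "(\<integral>t. exp (- \<i> * complex_of_real (t * \<xi>)) * complex_of_real (fejer t) \<partial>lborel)
    = complex_of_real (fejer_mass * tri \<xi>)"
  using integral_exp_even[OF fejer_integrable fejer_minus, of "- \<xi>"] integral_fejer_cos[of "-\<xi>"]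
  by (simp add: mult.commute)

lemma integral_exp_tri:
  "(\<integral>\<xi>. exp (\<i> * complex_of_real (t * \<xi>)) * complex_of_real (tri \<xi>) \<partial>lborel)
    = complex_of_real (2 * fejer t)"
  using integral_exp_even[OF tri_integrable tri_minus, of t] integral_tri_cos[of t] by simp

subsection \<open>Fourier multipliers acting on integrable functions\<close>

lemma inner_kernel_measurable [measurable]:
  "(\<lambda>(x::'a::euclidean_space, y). exp (c * complex_of_real (x \<bullet> y))) \<in> borel_measurable (borel \<Otimes>\<^sub>M borel)"
  unfolding borel_prod split_beta' by (intro borel_measurable_continuous_onI continuous_intros)

lemma cmod_exp_i_real [simp]:
  "cmod (exp (\<i> * complex_of_real r)) = 1" "cmod (exp (- (\<i> * complex_of_real r))) = 1"
  by (simp_all add: norm_exp_eq_Re)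

lemma IFT_measurable:
  fixes \<phi> :: "'a::euclidean_space \<Rightarrow> complex"
  assumes [measurable]: "\<phi> \<in> borel_measurable borel"
  shows "IFT \<phi> \<in> borel_measurable borel"
proof -
  have "(\<lambda>x. \<integral>y. exp (\<i> * complex_of_real (x \<bullet> y)) * \<phi> y \<partial>lborel) \<in> borel_measurable borel"
    by measurable
  then show ?thesis unfolding IFT_def[abs_def] by measurable
qed

lemma IFT_bound:
  fixes \<phi> :: "'a::euclidean_space \<Rightarrow> complex"
  assumes "integrable lborel \<phi>"
  shows "cmod (IFT \<phi> x) \<le> (\<integral>y. cmod (\<phi> y) \<partial>lborel) / (2 * pi) ^ DIM('a)"
proof -
  have "cmod (\<integral>y. exp (\<i> * complex_of_real (x \<bullet> y)) * \<phi> y \<partial>lborel) \<le> (\<integral>y. cmod (\<phi> y) \<partial>lborel)"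
    by (rule order_trans[OF integral_norm_bound]) (simp add: norm_mult)
  then show ?thesis
    by (simp add: IFT_def norm_mult norm_divide norm_power divide_right_mono)
qed

text \<open>Fubini moves both transforms off the Schwartz function \<open>\<phi>\<close>, so that Fourier inversion is only
  needed for the explicit wave packets.\<close>

lemma integral_FT_mult_IFT:
  fixes f g \<phi> :: "'a::euclidean_space \<Rightarrow> complex" and m :: "'a \<Rightarrow> real"
  assumes f: "integrable lborel f" and \<phi>: "integrable lborel \<phi>"
    and m: "integrable lborel (\<lambda>\<xi>. complex_of_real (m \<xi>))" and Fg: "integrable lborel (FT g)"
    and g: "\<And>\<xi>. complex_of_real (m \<xi>) * FT f \<xi> = FT g \<xi>"
  shows "(\<integral>x. f x * FT (\<lambda>\<xi>. complex_of_real (m \<xi>) * IFT \<phi> \<xi>) x \<partial>lborel)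
    = (\<integral>x. IFT (FT g) x * \<phi> x \<partial>lborel)"
proof -
  have [measurable]: "IFT \<phi> \<in> borel_measurable borel" "(\<lambda>\<xi>. complex_of_real (m \<xi>)) \<in> borel_measurable borel"
    using IFT_measurable \<phi> m by (auto dest!: borel_measurable_integrable)
  let ?u = "\<lambda>\<xi>. complex_of_real (m \<xi>) * IFT \<phi> \<xi>"
  have u: "integrable lborel ?u"
  proof (rule Bochner_Integration.integrable_bound)
    let ?B = "(\<integral>y. cmod (\<phi> y) \<partial>lborel) / (2 * pi) ^ DIM('a)"
    show "integrable lborel (\<lambda>\<xi>. ?B *\<^sub>R complex_of_real (m \<xi>))" using m by simp
    have "cmod (?u \<xi>) \<le> norm (?B *\<^sub>R complex_of_real (m \<xi>))" for \<xi>
      unfolding norm_mult norm_scaleR using mult_right_mono[OF order_trans[OF IFT_bound[OF \<phi>] abs_ge_self]]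
      by (subst mult.commute) auto
    then show "AE \<xi> in lborel. cmod (?u \<xi>) \<le> norm (?B *\<^sub>R complex_of_real (m \<xi>))" by simp
  qed simp
  have "(\<integral>x. f x * FT ?u x \<partial>lborel) = (\<integral>x. f x * (\<integral>\<xi>. exp (- \<i> * complex_of_real (x \<bullet> \<xi>)) * ?u \<xi> \<partial>lborel) \<partial>lborel)"
    by (simp add: FT_def inner_commute)
  also have "\<dots> = (\<integral>\<xi>. (\<integral>x. exp (- \<i> * complex_of_real (x \<bullet> \<xi>)) * f x \<partial>lborel) * ?u \<xi> \<partial>lborel)"
    by (rule Fubini_bounded_kernel[OF f u]) auto
  also have "\<dots> = (\<integral>\<xi>. complex_of_real (m \<xi>) * FT f \<xi> * IFT \<phi> \<xi> \<partial>lborel)"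
    unfolding FT_def by (intro Bochner_Integration.integral_cong refl) (simp only: mult_ac)
  also have "\<dots> = complex_of_real (1 / (2 * pi) ^ DIM('a)) *
      (\<integral>\<xi>. FT g \<xi> * (\<integral>x. exp (\<i> * complex_of_real (\<xi> \<bullet> x)) * \<phi> x \<partial>lborel) \<partial>lborel)"
    by (simp only: g IFT_def integral_mult_right_zero[symmetric] mult.left_commute)
  also have "(\<integral>\<xi>. FT g \<xi> * (\<integral>x. exp (\<i> * complex_of_real (\<xi> \<bullet> x)) * \<phi> x \<partial>lborel) \<partial>lborel)
     = (\<integral>x. (\<integral>\<xi>. exp (\<i> * complex_of_real (\<xi> \<bullet> x)) * FT g \<xi> \<partial>lborel) * \<phi> x \<partial>lborel)"
    by (rule Fubini_bounded_kernel[OF Fg \<phi>]) auto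
  also have "complex_of_real (1 / (2 * pi) ^ DIM('a)) * \<dots> = (\<integral>x. IFT (FT g) x * \<phi> x \<partial>lborel)"
    unfolding IFT_def integral_mult_right_zero[symmetric, where f="\<lambda>x. _ x * \<phi> x"]
    by (intro Bochner_Integration.integral_cong refl) (simp only: inner_commute mult.assoc)
  finally show ?thesis .
qed

subsection \<open>Wave packets\<close>

definition fejer_vec :: "real^'n::finite \<Rightarrow> real" where
  "fejer_vec x = (\<Prod>i\<in>UNIV. fejer (x $ i))"

definition tri_vec :: "real^'n::finite \<Rightarrow> real" where
  "tri_vec \<xi> = (\<Prod>i\<in>UNIV. tri (\<xi> $ i))"

definition wave :: "real^'n::finite \<Rightarrow> real^'n \<Rightarrow> real^'n \<Rightarrow> complex" where
  "wave w a x = exp (\<i> * complex_of_real (x \<bullet> w)) * complex_of_real (fejer_vec (x - a))"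

lemma fejer_vec_nonneg: "0 \<le> fejer_vec x"
  unfolding fejer_vec_def by (intro prod_nonneg fejer_nonneg)

lemma cmod_wave: "cmod (wave w a x) = fejer_vec (x - a)"
  by (simp add: wave_def norm_mult fejer_vec_nonneg)

lemma fejer_vec_le_1: "fejer_vec x \<le> 1"
proof -
  have "fejer t \<le> 1" for t using fejer_le_half[of t] by linarith
  then show ?thesis unfolding fejer_vec_def by (intro prod_le_1 conjI fejer_nonneg)
qed

lemma fejer_vec_integrable: "integrable lborel (fejer_vec :: real^'n::finite \<Rightarrow> real)"
proof -
  have "integrable lborel (\<lambda>x::real^'n. complex_of_real (fejer_vec x))"
    unfolding fejer_vec_def of_real_prod
    by (intro integrable_lborel_vec_prod integrable_of_real fejer_integrable)
  then show ?thesis by (simp add: complex_of_real_integrable_eq)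
qed

lemma tri_vec_integrable: "integrable lborel (tri_vec :: real^'n::finite \<Rightarrow> real)"
proof -
  have "integrable lborel (\<lambda>x::real^'n. complex_of_real (tri_vec x))"
    unfolding tri_vec_def of_real_prod
    by (intro integrable_lborel_vec_prod integrable_of_real tri_integrable)
  then show ?thesis by (simp add: complex_of_real_integrable_eq)
qed

lemma fejer_vec_measurable [measurable]: "fejer_vec \<in> borel_measurable borel"
  and tri_vec_measurable [measurable]: "tri_vec \<in> borel_measurable borel"
  using borel_measurable_integrable[OF fejer_vec_integrable] borel_measurable_integrable[OF tri_vec_integrable]
  by auto

lemma integral_exp_vec_prod:
  fixes g :: "real \<Rightarrow> real"
  assumes g: "integrable lborel g" and c: "Re c = 0"
  shows "(\<integral>x. exp (c * complex_of_real (x \<bullet> \<xi>)) * complex_of_real (\<Prod>i\<in>UNIV. g (x $ i)) \<partial>(lborel :: (real^'n::finite) measure))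
    = (\<Prod>i\<in>UNIV. \<integral>t. exp (c * complex_of_real (t * \<xi> $ i)) * complex_of_real (g t) \<partial>lborel)"
proof -
  have [measurable]: "g \<in> borel_measurable borel" using g by (auto dest!: borel_measurable_integrable)
  have "cmod (exp (c * complex_of_real r)) = 1" for r
    using c by simp
  then have "integrable lborel (\<lambda>t. exp (c * complex_of_real (t * \<xi> $ i)) * complex_of_real (g t))" for i
    by (intro Bochner_Integration.integrable_bound[OF g]) (auto simp: norm_mult c)
  from integral_lborel_vec_prod[OF this] show ?thesis
    by (simp add: inner_vec_def exp_sum sum_distrib_left prod.distrib)
qed

lemma FT_fejer_vec:
  "(\<integral>x. exp (- \<i> * complex_of_real (x \<bullet> \<xi>)) * complex_of_real (fejer_vec x) \<partial>(lborel :: (real^'n::finite) measure))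
    = complex_of_real (fejer_mass ^ CARD('n) * tri_vec \<xi>)"
    (is "?I = _")
proof -
  have "?I = (\<Prod>i\<in>UNIV. \<integral>t. exp (- \<i> * complex_of_real (t * \<xi> $ i)) * complex_of_real (fejer t) \<partial>lborel)"
    unfolding fejer_vec_def by (rule integral_exp_vec_prod[OF fejer_integrable]) simp
  also have "\<dots> = complex_of_real (fejer_mass ^ CARD('n) * tri_vec \<xi>)"
    unfolding integral_exp_fejer by (simp add: tri_vec_def prod.distrib)
  finally show ?thesis .
qed

lemma IFT_tri_vec:
  "(\<integral>\<xi>. exp (\<i> * complex_of_real (\<xi> \<bullet> x)) * complex_of_real (tri_vec \<xi>) \<partial>(lborel :: (real^'n::finite) measure))
    = complex_of_real (2 ^ CARD('n) * fejer_vec x)"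
proof -
  have "(\<integral>t. exp (\<i> * complex_of_real (t * x $ i)) * complex_of_real (tri t) \<partial>lborel) = complex_of_real (2 * fejer (x $ i))" for i
    using integral_exp_tri[of "x $ i"] by (simp add: mult.commute)
  then show ?thesis
    unfolding tri_vec_def
    by (subst integral_exp_vec_prod[OF tri_integrable]) (simp_all add: fejer_vec_def prod.distrib)
qed

lemma wave_integrable: "integrable lborel (wave w a :: real^'n::finite \<Rightarrow> complex)"
proof -
  have "(\<lambda>x::real^'n. exp (\<i> * complex_of_real (x \<bullet> w))) \<in> borel_measurable borel"
    by (intro borel_measurable_continuous_onI continuous_intros)
  then have "wave w a \<in> borel_measurable borel"
    unfolding wave_def[abs_def] by measurable
  then show ?thesis
    by (intro Bochner_Integration.integrable_bound[OF integral_lborel_translate(1)[OF fejer_vec_integrable, of a]])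
       (auto simp: cmod_wave fejer_vec_nonneg)
qed

lemma FT_wave:
  fixes w :: "real^'n::finite"
  shows "FT (wave w a) \<xi> = exp (- \<i> * complex_of_real ((\<xi> - w) \<bullet> a)) * complex_of_real (fejer_mass ^ CARD('n) * tri_vec (\<xi> - w))"
proof -
  \<comment> \<open>\<open>?G\<close> is the integrand in the variable centred at \<open>a\<close>;
    the constant phase in front is what the substitution leaves over.\<close>
  let ?G = "\<lambda>y. exp (- \<i> * complex_of_real ((\<xi> - w) \<bullet> a)) * (exp (- \<i> * complex_of_real (y \<bullet> (\<xi> - w))) * complex_of_real (fejer_vec y))"
  have "FT (wave w a) \<xi> = (\<integral>x. ?G (x - a) \<partial>lborel)"
    unfolding FT_def wave_def mult.assoc[symmetric] exp_add[symmetric]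
    by (intro Bochner_Integration.integral_cong refl arg_cong2[where f="(*)"] arg_cong[where f=exp])
       (simp add: algebra_simps inner_commute)
  also have "\<dots> = (\<integral>x. ?G x \<partial>lborel)"
  proof (rule integral_lborel_translate(2))
    have [measurable]: "(\<lambda>y::real^'n. exp (- \<i> * complex_of_real (y \<bullet> (\<xi> - w)))) \<in> borel_measurable borel"
      by (intro borel_measurable_continuous_onI continuous_intros)
    show "integrable lborel ?G"
      by (rule Bochner_Integration.integrable_bound[OF fejer_vec_integrable])
         (auto simp: norm_mult fejer_vec_nonneg)
  qed
  also have "\<dots> = exp (- \<i> * complex_of_real ((\<xi> - w) \<bullet> a)) * complex_of_real (fejer_mass ^ CARD('n) * tri_vec (\<xi> - w))"
    by (subst integral_mult_right_zero) (simp only: FT_fejer_vec)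
  finally show ?thesis .
qed

lemma FT_wave_integrable: "integrable lborel (FT (wave w a :: real^'n::finite \<Rightarrow> complex))"
proof -
  have "(\<lambda>\<xi>::real^'n. exp (- \<i> * complex_of_real ((\<xi> - w) \<bullet> a))) \<in> borel_measurable borel"
    by (intro borel_measurable_continuous_onI continuous_intros)
  then have "FT (wave w a) \<in> borel_measurable borel"
    unfolding FT_wave[abs_def] by measurable
  moreover have "cmod (FT (wave w a) \<xi>) = norm (fejer_mass ^ CARD('n) * tri_vec (\<xi> - w))" for \<xi>
    by (simp only: FT_wave norm_mult[where 'a=complex] norm_of_real mult_minus_left cmod_exp_i_real mult_1 real_norm_def)
  ultimately show ?thesis
    using integrable_mult_right[OF integral_lborel_translate(1)[OF tri_vec_integrable, of w], of "fejer_mass ^ CARD('n)"]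
    by (intro integrable_norm_cancel[of _ "FT (wave w a)"]) (simp_all only: integrable_norm, simp)
qed

text \<open>Its value is 1, since the Fejer integral equals pi. It is kept symbolic and divided out
  of the coefficients in \<open>fmult_packet_sum\<close>, so that only positivity of
  \<open>fejer_mass\<close> has to be proved.\<close>

definition packet_const :: "'n::finite itself \<Rightarrow> real" where
  "packet_const _ = (fejer_mass / pi) ^ CARD('n)"

lemma packet_const_pos: "packet_const TYPE('n::finite) > 0"
  using fejer_mass_pos by (simp add: packet_const_def)

text \<open>Inversion by direct computation: the transform of a packet is a modulated translate of
  \<open>tri_vec\<close>, whose inverse integral is again explicit. The factors
  \<open>fejer_mass\<close> and 2 per coordinate, against the normalisation \<open>2 * pi\<close>,
  give \<open>packet_const\<close>.\<close>

lemma IFT_FT_wave: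
  fixes w :: "real^'n::finite"
  shows "IFT (FT (wave w a)) x = complex_of_real (packet_const TYPE('n)) * wave w a x"
proof -
  let ?G = "\<lambda>y. (exp (\<i> * complex_of_real (x \<bullet> w)) * complex_of_real (fejer_mass ^ CARD('n))) * (exp (\<i> * complex_of_real (y \<bullet> (x - a))) * complex_of_real (tri_vec y))"
  have "exp (\<i> * complex_of_real (x \<bullet> \<xi>)) * exp (- \<i> * complex_of_real ((\<xi> - w) \<bullet> a))
      = exp (\<i> * complex_of_real (x \<bullet> w)) * exp (\<i> * complex_of_real ((\<xi> - w) \<bullet> (x - a)))" for \<xi>
    unfolding exp_add[symmetric]
    by (intro arg_cong[where f=exp]) (simp add: algebra_simps inner_commute)
  then have "(\<integral>\<xi>. exp (\<i> * complex_of_real (x \<bullet> \<xi>)) * FT (wave w a) \<xi> \<partial>lborel) = (\<integral>\<xi>. ?G (\<xi> - w) \<partial>lborel)"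
    unfolding FT_wave
    by (intro Bochner_Integration.integral_cong refl) (simp add: mult.assoc[symmetric])
  also have "\<dots> = (\<integral>x. ?G x \<partial>lborel)"
  proof (rule integral_lborel_translate(2))
    have [measurable]: "(\<lambda>y::real^'n. exp (\<i> * complex_of_real (y \<bullet> (x - a)))) \<in> borel_measurable borel"
      by (intro borel_measurable_continuous_onI continuous_intros)
    show "integrable lborel ?G"
      by (rule Bochner_Integration.integrable_bound[OF integrable_mult_right[OF tri_vec_integrable, of "fejer_mass ^ CARD('n)"]])
         (auto simp: norm_mult abs_mult norm_power power_abs)
  qed
  also have "\<dots> = (exp (\<i> * complex_of_real (x \<bullet> w)) * complex_of_real (fejer_mass ^ CARD('n))) * complex_of_real (2 ^ CARD('n) * fejer_vec (x - a))"
    by (subst integral_mult_right_zero) (simp only: IFT_tri_vec)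
  finally have "IFT (FT (wave w a)) x = complex_of_real (1 / (2 * pi) ^ CARD('n)) * (exp (\<i> * complex_of_real (x \<bullet> w)) *
      complex_of_real (fejer_mass ^ CARD('n)) * complex_of_real (2 ^ CARD('n) * fejer_vec (x - a)))"
    by (simp only: IFT_def DIM_cart DIM_real mult_1_right)
  also have "\<dots> = complex_of_real (1 / (2 * pi) ^ CARD('n) * fejer_mass ^ CARD('n) * 2 ^ CARD('n)) * wave w a x"
    by (simp only: wave_def of_real_mult mult_ac)
  also have "1 / (2 * pi) ^ CARD('n) * fejer_mass ^ CARD('n) * 2 ^ CARD('n) = packet_const TYPE('n)"
    by (simp add: packet_const_def power_divide power_mult_distrib)
  finally show ?thesis .
qed

definition packet_sum :: "nat set \<Rightarrow> (nat \<Rightarrow> complex) \<Rightarrow> (nat \<Rightarrow> real^'n::finite) \<Rightarrow> (nat \<Rightarrow> real^'n) \<Rightarrow> real^'n \<Rightarrow> complex" where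
  "packet_sum K e w a x = (\<Sum>k\<in>K. e k * wave (w k) (a k) x)"

lemma packet_sum_integrable: "integrable lborel (packet_sum K e w a)"
  unfolding packet_sum_def[abs_def]
  by (intro Bochner_Integration.integrable_sum integrable_mult_right wave_integrable)

lemma integrable_exp_mult:
  fixes f :: "'a::euclidean_space \<Rightarrow> complex"
  assumes f: "integrable lborel f" and c: "Re c = 0"
  shows "integrable lborel (\<lambda>x. exp (c * complex_of_real (x \<bullet> y)) * f x)"
proof -
  have [measurable]: "f \<in> borel_measurable borel" "(\<lambda>x. exp (c * complex_of_real (x \<bullet> y))) \<in> borel_measurable borel"
    using f by (auto dest!: borel_measurable_integrable intro!: borel_measurable_continuous_onI continuous_intros)
  show ?thesis
    by (rule Bochner_Integration.integrable_bound[OF f]) (auto simp: norm_mult c)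
qed

lemma FT_sum:
  assumes "\<And>k. k \<in> K \<Longrightarrow> integrable lborel (f k)"
  shows "FT (\<lambda>x. \<Sum>k\<in>K. e k * f k x) \<xi> = (\<Sum>k\<in>K. e k * FT (f k) \<xi>)"
proof -
  have "FT (\<lambda>x. \<Sum>k\<in>K. e k * f k x) \<xi> = (\<integral>x. (\<Sum>k\<in>K. e k * (exp (- \<i> * complex_of_real (x \<bullet> \<xi>)) * f k x)) \<partial>lborel)"
    unfolding FT_def sum_distrib_left by (simp only: mult.left_commute)
  also have "\<dots> = (\<Sum>k\<in>K. \<integral>x. e k * (exp (- \<i> * complex_of_real (x \<bullet> \<xi>)) * f k x) \<partial>lborel)"
    using assms by (intro Bochner_Integration.integral_sum integrable_mult_right integrable_exp_mult) auto
  finally show ?thesis unfolding FT_def by (simp only: integral_mult_right_zero)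
qed

lemma IFT_sum:
  fixes f :: "'i \<Rightarrow> 'a::euclidean_space \<Rightarrow> complex"
  assumes "\<And>k. k \<in> K \<Longrightarrow> integrable lborel (f k)"
  shows "IFT (\<lambda>x. \<Sum>k\<in>K. e k * f k x) \<xi> = (\<Sum>k\<in>K. e k * IFT (f k) \<xi>)"
proof -
  have "IFT (\<lambda>x. \<Sum>k\<in>K. e k * f k x) \<xi> = complex_of_real (1 / (2 * pi) ^ DIM('a)) *
      (\<integral>x. (\<Sum>k\<in>K. e k * (exp (\<i> * complex_of_real (x \<bullet> \<xi>)) * f k x)) \<partial>lborel)"
    unfolding IFT_def sum_distrib_left by (simp only: mult.left_commute inner_commute)
  also have "(\<integral>x. (\<Sum>k\<in>K. e k * (exp (\<i> * complex_of_real (x \<bullet> \<xi>)) * f k x)) \<partial>lborel)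
     = (\<Sum>k\<in>K. \<integral>x. e k * (exp (\<i> * complex_of_real (x \<bullet> \<xi>)) * f k x) \<partial>lborel)"
    using assms by (intro Bochner_Integration.integral_sum integrable_mult_right integrable_exp_mult) auto
  finally show ?thesis
    unfolding IFT_def by (simp only: integral_mult_right_zero sum_distrib_left mult.left_commute inner_commute)
qed

lemma FT_packet_sum: "FT (packet_sum K e w a) = (\<lambda>\<xi>. \<Sum>k\<in>K. e k * FT (wave (w k) (a k)) \<xi>)"
  unfolding packet_sum_def[abs_def] by (intro ext FT_sum wave_integrable)

lemma FT_packet_sum_integrable: "integrable lborel (FT (packet_sum K e w a))"
  unfolding FT_packet_sum
  by (intro Bochner_Integration.integrable_sum integrable_mult_right FT_wave_integrable)

lemma IFT_FT_packet_sum: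
  fixes w :: "nat \<Rightarrow> real^'n::finite"
  shows "IFT (FT (packet_sum K e w a)) x = complex_of_real (packet_const TYPE('n)) * packet_sum K e w a x"
proof -
  have "IFT (FT (packet_sum K e w a)) x = (\<Sum>k\<in>K. e k * IFT (FT (wave (w k) (a k))) x)"
    unfolding FT_packet_sum by (intro IFT_sum FT_wave_integrable)
  then show ?thesis
    by (simp only: IFT_FT_wave packet_sum_def sum_distrib_left mult.left_commute)
qed

subsection \<open>Gaussian packets are Schwartz functions\<close>

text \<open>Polynomial prefactors that arise when a Gaussian packet is differentiated. Generating
  them inductively makes closure under directional derivatives and polynomial growth two short
  inductions.\<close>

inductive cpoly :: "('a::euclidean_space \<Rightarrow> complex) \<Rightarrow> bool" where
  cpoly_const: "cpoly (\<lambda>x. c)"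
| cpoly_coord: "cpoly (\<lambda>x. complex_of_real (x \<bullet> b))"
| cpoly_add: "cpoly P \<Longrightarrow> cpoly Q \<Longrightarrow> cpoly (\<lambda>x. P x + Q x)"
| cpoly_mult: "cpoly P \<Longrightarrow> cpoly Q \<Longrightarrow> cpoly (\<lambda>x. P x * Q x)"

lemma cpoly_derivative:
  assumes "cpoly P"
  shows "\<exists>P'. cpoly P' \<and> (\<forall>x. ((\<lambda>t. P (x + t *\<^sub>R i)) has_vector_derivative P' x) (at 0))"
  using assms
proof induction
  case (cpoly_const c)
  show ?case by (intro exI[of _ "\<lambda>x. 0"]) (auto intro: cpoly.cpoly_const)
next
  case (cpoly_coord b)
  show ?case
    by (intro exI[of _ "\<lambda>x. complex_of_real (i \<bullet> b)"] conjI allI cpoly.cpoly_const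
        has_vector_derivative_of_real)
       (auto intro!: derivative_eq_intros simp: inner_add_left)
next
  case (cpoly_add P Q)
  then obtain P' Q' where
    "cpoly P'" "\<And>x. ((\<lambda>t. P (x + t *\<^sub>R i)) has_vector_derivative P' x) (at 0)"
    "cpoly Q'" "\<And>x. ((\<lambda>t. Q (x + t *\<^sub>R i)) has_vector_derivative Q' x) (at 0)" by blast
  then show ?case
    by (intro exI[of _ "\<lambda>x. P' x + Q' x"] conjI allI cpoly.cpoly_add has_vector_derivative_add) auto
next
  case (cpoly_mult P Q)
  then obtain P' Q' where *:
    "cpoly P'" "\<And>x. ((\<lambda>t. P (x + t *\<^sub>R i)) has_vector_derivative P' x) (at 0)"
    "cpoly Q'" "\<And>x. ((\<lambda>t. Q (x + t *\<^sub>R i)) has_vector_derivative Q' x) (at 0)" by blast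
  have "((\<lambda>t. P (x + t *\<^sub>R i) * Q (x + t *\<^sub>R i)) has_vector_derivative P x * Q' x + P' x * Q x) (at 0)" for x
    using has_vector_derivative_mult[OF *(2,4)] by simp
  with * cpoly_mult show ?case
    by (intro exI[of _ "\<lambda>x. P x * Q' x + P' x * Q x"] conjI allI cpoly.cpoly_add cpoly.cpoly_mult) auto
qed

lemma cpoly_growth:
  assumes "cpoly P"
  shows "\<exists>C M. C \<ge> 0 \<and> (\<forall>x. cmod (P x) \<le> C * (1 + norm x) ^ M)"
  using assms
proof induction
  case (cpoly_const c)
  show ?case by (intro exI[of _ "cmod c"] exI[of _ 0]) auto
next
  case (cpoly_coord b)
  have "\<bar>x \<bullet> b\<bar> \<le> norm b * (1 + norm x) ^ 1" for x
    using Cauchy_Schwarz_ineq2[of x b] by (simp add: algebra_simps add_increasing2 add_increasing)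
  then show ?case by (intro exI[of _ "norm b"] exI[of _ 1]) auto
next
  case (cpoly_add P Q)
  then obtain C M D L where *: "C \<ge> 0" "D \<ge> 0"
    "\<And>x. cmod (P x) \<le> C * (1 + norm x) ^ M" "\<And>x. cmod (Q x) \<le> D * (1 + norm x) ^ L" by blast
  have "cmod (P x + Q x) \<le> (C + D) * (1 + norm x) ^ (M + L)" for x
  proof -
    have "(1 + norm x) ^ M \<le> (1 + norm x) ^ (M + L)" "(1 + norm x) ^ L \<le> (1 + norm x) ^ (M + L)"
      by (intro power_increasing; simp)+
    then have "C * (1 + norm x) ^ M + D * (1 + norm x) ^ L \<le> C * (1 + norm x) ^ (M + L) + D * (1 + norm x) ^ (M + L)"
      using *(1,2) by (intro add_mono mult_left_mono) auto
    then show ?thesis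
      using norm_triangle_ineq[of "P x" "Q x"] *(3)[of x] *(4)[of x] by (simp add: distrib_right)
  qed
  then show ?case using *(1,2) by (intro exI[of _ "C + D"] exI[of _ "M + L"]) auto
next
  case (cpoly_mult P Q)
  then obtain C M D L where *: "C \<ge> 0" "D \<ge> 0"
    "\<And>x. cmod (P x) \<le> C * (1 + norm x) ^ M" "\<And>x. cmod (Q x) \<le> D * (1 + norm x) ^ L" by blast
  have "cmod (P x * Q x) \<le> (C * D) * (1 + norm x) ^ (M + L)" for x
    using mult_mono[OF *(3)[of x] *(4)[of x]] *(1,2)
    by (simp add: norm_mult power_add mult.assoc mult.left_commute)
  then show ?case using *(1,2) by (intro exI[of _ "C * D"] exI[of _ "M + L"]) auto
qed

text \<open>The phase is opposite to that of \<open>wave w a\<close>, so it cancels the oscillation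
  of the packet it is tested against. The Gaussian envelope makes every derivative a polynomial
  multiple of the same function.\<close>

definition gauss_packet :: "'a::euclidean_space \<Rightarrow> 'a \<Rightarrow> 'a \<Rightarrow> complex" where
  "gauss_packet w a x = exp (- \<i> * complex_of_real (x \<bullet> w) - complex_of_real ((x - a) \<bullet> (x - a)) / 2)"

lemma cmod_gauss_packet: "cmod (gauss_packet w a x) = exp (- (norm (x - a))\<^sup>2 / 2)"
  by (simp add: gauss_packet_def power2_norm_eq_inner)

text \<open>With \<open>r\<close> the distance to the centre, \<open>1 + norm x\<close> is at most
  \<open>(1 + norm a) * (1 + r)\<close> and \<open>1 + r \<le> exp r\<close>. The exponent
  \<open>N * r - r\<^sup>2 / 2\<close> is then maximised by completing the square.\<close>

lemma gauss_packet_decay: "(1 + norm x) ^ N * cmod (gauss_packet w a x) \<le> (1 + norm a) ^ N * exp ((real N)\<^sup>2 / 2)"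
proof -
  define r where "r = norm (x - a)"
  have r: "r \<ge> 0" by (simp add: r_def)
  have "norm x \<le> r + norm a" unfolding r_def by norm
  also have "1 + (r + norm a) \<le> (1 + norm a) * (1 + r)" using r by (simp add: algebra_simps)
  finally have "(1 + norm x) ^ N \<le> ((1 + norm a) * (1 + r)) ^ N" by (intro power_mono) auto
  also have "\<dots> = (1 + norm a) ^ N * (1 + r) ^ N" by (rule power_mult_distrib)
  also have "\<dots> \<le> (1 + norm a) ^ N * exp r ^ N"
    using r exp_ge_add_one_self[of r] by (intro mult_left_mono power_mono) auto
  finally have "(1 + norm x) ^ N * cmod (gauss_packet w a x) \<le> (1 + norm a) ^ N * exp r ^ N * exp (- r\<^sup>2 / 2)"
    unfolding cmod_gauss_packet r_def by (intro mult_right_mono) auto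
  also have "\<dots> = (1 + norm a) ^ N * exp (N * r - r\<^sup>2 / 2)"
    by (simp add: exp_of_nat_mult[symmetric] exp_add[symmetric])
  also have "\<dots> \<le> (1 + norm a) ^ N * exp ((real N)\<^sup>2 / 2)"
    using zero_le_power2[of "r - N"] by (intro mult_left_mono) (auto simp: power2_diff algebra_simps)
  finally show ?thesis .
qed

lemma gauss_packet_derivative:
  "((\<lambda>t. gauss_packet w a (x + t *\<^sub>R i)) has_vector_derivative
     (- \<i> * complex_of_real (i \<bullet> w) - complex_of_real ((x - a) \<bullet> i)) * gauss_packet w a x) (at 0)"
proof -
  have "((\<lambda>t. - \<i> * complex_of_real ((x + t *\<^sub>R i) \<bullet> w) - complex_of_real ((x + t *\<^sub>R i - a) \<bullet> (x + t *\<^sub>R i - a)) / 2)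
    has_vector_derivative (- \<i> * complex_of_real (i \<bullet> w) - complex_of_real (2 * ((x - a) \<bullet> i)) / 2)) (at 0)"
    by (intro has_vector_derivative_diff has_vector_derivative_mult_right has_vector_derivative_divide has_vector_derivative_of_real)
       (auto intro!: derivative_eq_intros simp: inner_simps inner_commute algebra_simps)
  from field_vector_diff_chain_at[OF this DERIV_exp]
  show ?thesis by (simp add: gauss_packet_def[abs_def] o_def)
qed

text \<open>The polynomial factor is the strengthening that lets the induction over the multi-index
  go through: the class of polynomial multiples of one packet is closed under differentiation, and
  growth of the polynomial is absorbed by the Gaussian decay.\<close>

lemma schwartz_cpoly_gauss_packet:
  assumes "cpoly P"
  shows "schwartz (\<lambda>x. P x * gauss_packet w a x)"
proof -
  have D: "\<exists>Q. cpoly Q \<and> (\<forall>x. ((\<lambda>t. P (x + t *\<^sub>R i) * gauss_packet w a (x + t *\<^sub>R i)) has_vector_derivative (Q x * gauss_packet w a x)) (at 0))"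
    if P: "cpoly P" for P and i :: 'a
  proof -
    obtain P' where P': "cpoly P'" "\<And>x. ((\<lambda>t. P (x + t *\<^sub>R i)) has_vector_derivative P' x) (at 0)"
      using cpoly_derivative[OF P] by blast
    \<comment> \<open>The logarithmic derivative of the packet in direction \<open>i\<close>, split
      into a constant and a linear term so that it is visibly a \<open>cpoly\<close>.\<close>
    define R where "R x = (- \<i> * complex_of_real (i \<bullet> w) + complex_of_real (a \<bullet> i)) + (-1) * complex_of_real (x \<bullet> i)" for x
    have "cpoly R" unfolding R_def by (intro cpoly.intros)
    then have "cpoly (\<lambda>x. P x * R x + P' x)" by (intro cpoly.intros P P')
    moreover have "((\<lambda>t. P (x + t *\<^sub>R i) * gauss_packet w a (x + t *\<^sub>R i)) has_vector_derivative ((P x * R x + P' x) * gauss_packet w a x)) (at 0)" for x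
      using has_vector_derivative_mult[OF P'(2) gauss_packet_derivative, of x w a]
      by (simp add: R_def inner_simps algebra_simps)
    ultimately show ?thesis by (intro exI[of _ "\<lambda>x. P x * R x + P' x"]) auto
  qed
  have *: "\<exists>Q. cpoly Q \<and> Dmulti al (\<lambda>x. P x * gauss_packet w a x) = (\<lambda>x. Q x * gauss_packet w a x)" for al
  proof (induction al)
    case Nil
    then show ?case using assms by auto
  next
    case (Cons i al)
    then obtain Q where Q: "cpoly Q" "Dmulti al (\<lambda>x. P x * gauss_packet w a x) = (\<lambda>x. Q x * gauss_packet w a x)"
      by blast
    obtain R where R: "cpoly R" "\<And>x. ((\<lambda>t. Q (x + t *\<^sub>R i) * gauss_packet w a (x + t *\<^sub>R i)) has_vector_derivative (R x * gauss_packet w a x)) (at 0)"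
      using D[OF Q(1)] by blast
    show ?case
      using R by (intro exI[of _ R]) (auto simp: Q(2) pderiv_dir_def fun_eq_iff intro!: vector_derivative_at)
  qed
  show ?thesis
    unfolding schwartz_def
  proof (intro allI impI conjI ballI)
    fix al :: "'a list" and i x :: 'a
    obtain Q where Q: "cpoly Q" "Dmulti al (\<lambda>x. P x * gauss_packet w a x) = (\<lambda>x. Q x * gauss_packet w a x)"
      using * by blast
    show "(\<lambda>t. Dmulti al (\<lambda>x. P x * gauss_packet w a x) (x + t *\<^sub>R i)) differentiable (at 0)"
      using D[OF Q(1), of i] unfolding Q(2) by (blast intro: differentiableI_vector)
  next
    fix al :: "'a list" and N
    obtain Q where Q: "cpoly Q" "Dmulti al (\<lambda>x. P x * gauss_packet w a x) = (\<lambda>x. Q x * gauss_packet w a x)"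
      using * by blast
    obtain C M where C: "C \<ge> 0" "\<And>x. cmod (Q x) \<le> C * (1 + norm x) ^ M"
      using cpoly_growth[OF Q(1)] by blast
    have "(1 + norm x) ^ N * cmod (Q x * gauss_packet w a x) \<le> C * ((1 + norm a) ^ (N + M) * exp ((real (N + M))\<^sup>2 / 2))" for x
    proof -
      have "(1 + norm x) ^ N * cmod (Q x * gauss_packet w a x) \<le> (1 + norm x) ^ N * (C * (1 + norm x) ^ M * cmod (gauss_packet w a x))"
        unfolding norm_mult using C by (intro mult_left_mono mult_right_mono) auto
      also have "\<dots> = C * ((1 + norm x) ^ (N + M) * cmod (gauss_packet w a x))"
        by (simp add: power_add)
      also have "\<dots> \<le> C * ((1 + norm a) ^ (N + M) * exp ((real (N + M))\<^sup>2 / 2))"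
        using C(1) by (intro mult_left_mono gauss_packet_decay)
      finally show ?thesis .
    qed
    then show "bounded (range (\<lambda>x. (1 + norm x) ^ N * cmod (Dmulti al (\<lambda>x. P x * gauss_packet w a x) x)))"
      unfolding Q(2) by (intro boundedI[where B="C * ((1 + norm a) ^ (N + M) * exp ((real (N + M))\<^sup>2 / 2))"]) auto
  qed
qed

lemma schwartz_gauss_packet: "schwartz (gauss_packet w a)"
  using schwartz_cpoly_gauss_packet[OF cpoly_const[of 1]] by simp

subsection \<open>Tempered distributions and dyadic multipliers\<close>

lemma schwartz_bounded_mult_integrable:
  assumes f: "integrable lborel f" and \<phi>: "schwartz \<phi>"
  shows "integrable lborel (\<lambda>x. f x * \<phi> x)"
proof -
  have [measurable]: "f \<in> borel_measurable borel" "\<phi> \<in> borel_measurable borel"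
    using f schwartz_integrable[OF \<phi>] by (auto dest!: borel_measurable_integrable)
  obtain C where C: "C \<ge> 0" "\<And>x. (1 + norm x) ^ 0 * cmod (\<phi> x) \<le> C"
    using schwartz_decay[OF \<phi>] by blast
  have "norm (f x * \<phi> x) \<le> norm (C *\<^sub>R f x)" for x
    using C(1) mult_left_mono[OF C(2)[of x], of "cmod (f x)"] by (simp add: norm_mult mult.commute)
  then show ?thesis
    by (intro Bochner_Integration.integrable_bound[OF integrable_scaleR_right[OF f, of C]] AE_I2) simp_all
qed

lemma tempered_integral:
  fixes f :: "'a::euclidean_space \<Rightarrow> complex"
  assumes f: "integrable lborel f"
  shows "tempered (\<lambda>\<phi>. \<integral>x. f x * \<phi> x \<partial>lborel)"
proof -
  have "cmod (\<integral>x. f x * \<phi> x \<partial>lborel) \<le> (\<integral>x. cmod (f x) \<partial>lborel) * schwartz_seminorm 0 0 \<phi>"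
    if \<phi>: "schwartz \<phi>" for \<phi>
  proof -
    \<comment> \<open>At order 0 the multi-index must be empty and the weight is 1, so this seminorm
      is the supremum norm, which suffices against an integrable \<open>f\<close>.\<close>
    have *: "{(1 + norm x) ^ 0 * cmod (Dmulti al \<phi> x) | x al. set al \<subseteq> Basis \<and> length al \<le> 0} = range (\<lambda>x. cmod (\<phi> x))"
      by force
    obtain C where "\<And>x. (1 + norm x) ^ 0 * cmod (\<phi> x) \<le> C"
      using schwartz_decay[OF \<phi>] by blast
    then have "bdd_above (range (\<lambda>x. cmod (\<phi> x)))" by (intro bdd_aboveI[of _ C]) auto
    then have S: "cmod (\<phi> x) \<le> schwartz_seminorm 0 0 \<phi>" for x
      unfolding schwartz_seminorm_def * by (intro cSup_upper) auto
    have "cmod (\<integral>x. f x * \<phi> x \<partial>lborel) \<le> (\<integral>x. cmod (f x * \<phi> x) \<partial>lborel)"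
      by (rule integral_norm_bound)
    also have "\<dots> \<le> (\<integral>x. cmod (f x) * schwartz_seminorm 0 0 \<phi> \<partial>lborel)"
    proof (rule integral_mono)
      show "integrable lborel (\<lambda>x. cmod (f x * \<phi> x))"
        by (rule integrable_norm[OF schwartz_bounded_mult_integrable[OF f \<phi>]])
      show "integrable lborel (\<lambda>x. cmod (f x) * schwartz_seminorm 0 0 \<phi>)"
        using f by simp
      show "cmod (f x * \<phi> x) \<le> cmod (f x) * schwartz_seminorm 0 0 \<phi>" for x
        unfolding norm_mult by (rule mult_left_mono[OF S]) simp
    qed
    finally show ?thesis by simp
  qed
  moreover have "(\<integral>x. f x * (\<phi> x + \<psi> x) \<partial>lborel) = (\<integral>x. f x * \<phi> x \<partial>lborel) + (\<integral>x. f x * \<psi> x \<partial>lborel)"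
    if "schwartz \<phi>" "schwartz \<psi>" for \<phi> \<psi>
    using that[THEN schwartz_bounded_mult_integrable[OF f]] by (simp add: distrib_left)
  moreover have "(\<integral>x. f x * (c * \<phi> x) \<partial>lborel) = c * (\<integral>x. f x * \<phi> x \<partial>lborel)" for c \<phi>
    by (simp add: mult.left_commute)
  ultimately show ?thesis unfolding tempered_def by blast
qed

lemma integrable_C0inf_scale:
  fixes \<psi> :: "'a::euclidean_space \<Rightarrow> real"
  assumes \<psi>: "C0inf \<psi>" and c: "c > 0"
  shows "integrable lborel (\<lambda>x. complex_of_real (\<psi> (c *\<^sub>R x)))"
proof -
  have "continuous_on UNIV (\<lambda>x. complex_of_real (\<psi> x))"
    using \<psi> by (intro schwartz_continuous) (simp add: C0inf_def)
  then have cont: "continuous_on S (\<lambda>x. complex_of_real (\<psi> (c *\<^sub>R x)))" for S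
    by (rule continuous_on_compose2) (auto intro!: continuous_intros)
  obtain R where R: "\<And>x. \<psi> x \<noteq> 0 \<Longrightarrow> norm x \<le> R"
    using \<psi> unfolding C0inf_def bounded_iff by auto
  have "\<psi> (c *\<^sub>R x) = 0" if "x \<notin> cball 0 (R / c)" for x
  proof (rule ccontr)
    assume "\<psi> (c *\<^sub>R x) \<noteq> 0"
    from R[OF this] c that show False by (simp add: field_simps)
  qed
  then have "(\<lambda>x. indicator (cball 0 (R / c)) x *\<^sub>R complex_of_real (\<psi> (c *\<^sub>R x))) = (\<lambda>x. complex_of_real (\<psi> (c *\<^sub>R x)))"
    by (auto simp: fun_eq_iff indicator_def)
  with borel_integrable_compact[OF compact_cball cont, of 0 "R / c"] show ?thesis by (simp only:)
qed

lemma dyadic_iso_integrable: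
  fixes \<psi>0 :: "real^'n::finite \<Rightarrow> real"
  assumes "C0inf \<psi>0"
  shows "integrable lborel (\<lambda>x. complex_of_real (dyadic_iso \<psi>0 j x))"
proof (cases "j = 0")
  case True
  then show ?thesis using integrable_C0inf_scale[OF assms, of 1] by (simp add: dyadic_iso_def)
next
  case False
  then show ?thesis
    using Bochner_Integration.integrable_diff[OF integrable_C0inf_scale[OF assms, of "1 / 2 ^ j"]
        integrable_C0inf_scale[OF assms, of "1 / 2 ^ (j - 1)"]]
    by (simp add: dyadic_iso_def)
qed

lemma dyadic_1d_integrable:
  assumes "C0inf \<phi>0"
  shows "integrable lborel (\<lambda>x. complex_of_real (dyadic_1d \<phi>0 j x))"
proof (cases "j = 0")
  case True
  then show ?thesis using integrable_C0inf_scale[OF assms, of 1] by (simp add: dyadic_1d_def)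
next
  case False
  then show ?thesis
    using Bochner_Integration.integrable_diff[OF integrable_C0inf_scale[OF assms, of "1 / 2 ^ j"]
        integrable_C0inf_scale[OF assms, of "1 / 2 ^ (j - 1)"]]
    by (simp add: dyadic_1d_def)
qed

lemma dyadic_mixed_integrable:
  fixes k :: "'n::finite \<Rightarrow> nat"
  assumes "C0inf \<phi>0"
  shows "integrable lborel (\<lambda>x. complex_of_real (dyadic_mixed \<phi>0 k x))"
  unfolding dyadic_mixed_def of_real_prod
  by (intro integrable_lborel_vec_prod dyadic_1d_integrable assms)

subsection \<open>Dyadic multipliers on a packet\<close>

text \<open>The number 7/8 is the midpoint of 3/4 and 1. On \<open>[3/4 * 2^J, 2^J]\<close> the
  dyadic function of index \<open>J\<close> equals 1 and all others vanish; for
  \<open>J \<ge> 3\<close> the half-width \<open>2^J / 8\<close> of this interval is at least 1,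
  which leaves room for the unit cube carrying the transform of a packet.\<close>

definition freq :: "'n::finite \<Rightarrow> 'n \<Rightarrow> nat \<Rightarrow> nat \<Rightarrow> real^'n" where
  "freq i1 i2 J k = (\<chi> i. if i = i1 then 7/8 * 2 ^ J else if i = i2 then 7/8 * 2 ^ k else 0)"

lemma dyadic_scale:
  assumes "7/8 * 2 ^ J - 1 < t" "t < 7/8 * 2 ^ J + (1::real)" "3 \<le> J"
  shows "J \<le> j \<Longrightarrow> \<bar>t / 2 ^ j\<bar> \<le> 1" "j < J \<Longrightarrow> 3/2 \<le> \<bar>t / 2 ^ j\<bar>"
proof -
  have 8: "(8::real) \<le> 2 ^ J"
    using power_increasing[OF assms(3), of "2::real"] by simp
  then have t: "0 < t" "3/4 * 2 ^ J \<le> t" "t \<le> 2 ^ J" using assms by auto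
  show "\<bar>t / 2 ^ j\<bar> \<le> 1" if "J \<le> j"
    using t order_trans[OF t(3) power_increasing[OF that, of "2::real"]] by simp
  show "3/2 \<le> \<bar>t / 2 ^ j\<bar>" if "j < J"
  proof -
    \<comment> \<open>One scale lower already costs a factor 2, which turns the lower bound 3/4 into
      3/2, the edge of the support of the cut-off.\<close>
    have "(2::real) * 2 ^ j \<le> 2 ^ J" using power_increasing[of "Suc j" J "2::real"] that by simp
    then show ?thesis using t by (simp add: le_divide_eq)
  qed
qed

text \<open>As a function of \<open>j\<close>, the value \<open>\<phi>0 (t / 2 ^ j)\<close> is a
  step from 0 to 1 at \<open>j = J\<close>. The dyadic functions with \<open>j > 0\<close> are its
  successive differences, so only \<open>j = J\<close> survives; \<open>3 \<le> J\<close> excludes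
  the separate case \<open>j = 0\<close>.\<close>

lemma dyadic_1d_shell:
  fixes t :: real
  assumes \<phi>: "\<And>t. \<bar>t\<bar> \<le> 1 \<Longrightarrow> \<phi>0 t = 1" "\<And>t. \<bar>t\<bar> \<ge> 3/2 \<Longrightarrow> \<phi>0 t = 0"
    and t: "7/8 * 2 ^ J - 1 < t" "t < 7/8 * 2 ^ J + 1" "3 \<le> J"
  shows "dyadic_1d \<phi>0 j t = (if j = J then 1 else 0)"
proof -
  have v: "\<phi>0 (t / 2 ^ j) = (if J \<le> j then 1 else 0)" for j
    using dyadic_scale[OF t, of j] \<phi>(1)[of "t / 2 ^ j"] \<phi>(2)[of "t / 2 ^ j"] by auto
  show ?thesis
    using v[of 0] v[of j] v[of "j - 1"] t(3) by (auto simp: dyadic_1d_def)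
qed

lemma dyadic_1d_origin:
  fixes t :: real
  assumes \<phi>: "\<And>t. \<bar>t\<bar> \<le> 1 \<Longrightarrow> \<phi>0 t = 1" and t: "\<bar>t\<bar> \<le> 1"
  shows "dyadic_1d \<phi>0 j t = (if j = 0 then 1 else 0)"
proof -
  have "\<bar>t / 2 ^ j\<bar> \<le> 1" for j
    using t one_le_power[of "2::real" j] by (simp add: divide_le_eq order_trans)
  then have "\<phi>0 (t / 2 ^ j) = 1" for j by (rule \<phi>)
  from this[of 0] this[of j] this[of "j - 1"] show ?thesis by (simp add: dyadic_1d_def)
qed

lemma FT_wave_support:
  fixes w :: "real^'n::finite"
  assumes "FT (wave w a) \<xi> \<noteq> 0"
  shows "\<bar>\<xi> $ i - w $ i\<bar> < 1"
proof (rule ccontr)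
  assume "\<not> \<bar>\<xi> $ i - w $ i\<bar> < 1"
  then have "tri ((\<xi> - w) $ i) = 0" by (simp add: tri_def)
  then have "tri_vec (\<xi> - w) = 0" unfolding tri_vec_def by (intro prod_zero) auto
  then show False using assms by (simp add: FT_wave)
qed

text \<open>Only frequencies in the support cube of the transform matter. There each one-dimensional
  factor is 0 or 1: coordinate \<open>i1\<close> selects block \<open>J\<close>, \<open>i2\<close>
  selects block \<open>k\<close>, and all others select block 0. Hence different \<open>k\<close>
  lead to different mixed blocks.\<close>

lemma dyadic_mixed_FT_wave:
  fixes i1 i2 :: "'n::finite"
  assumes \<phi>: "\<And>t. \<bar>t\<bar> \<le> 1 \<Longrightarrow> \<phi>0 t = 1" "\<And>t. \<bar>t\<bar> \<ge> 3/2 \<Longrightarrow> \<phi>0 t = 0"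
    and J: "3 \<le> k" "k \<le> J" and i: "i1 \<noteq> i2"
  shows "complex_of_real (dyadic_mixed \<phi>0 m \<xi>) * FT (wave (freq i1 i2 J k) a) \<xi>
    = (if m = (\<lambda>i. if i = i1 then J else if i = i2 then k else 0) then 1 else 0) * FT (wave (freq i1 i2 J k) a) \<xi>"
proof (cases "FT (wave (freq i1 i2 J k) a) \<xi> = 0")
  case False
  let ?m = "\<lambda>i. if i = i1 then J else if i = i2 then k else 0"
  have "dyadic_1d \<phi>0 (m i) (\<xi> $ i) = (if m i = ?m i then 1 else 0)" for i
  proof -
    have s: "\<bar>\<xi> $ i - freq i1 i2 J k $ i\<bar> < 1" by (rule FT_wave_support[OF False])
    consider "i = i1" | "i \<noteq> i1" "i = i2" | "i \<noteq> i1" "i \<noteq> i2" by blast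
    then show ?thesis
    proof cases
      case 1
      with s J show ?thesis by (subst dyadic_1d_shell[OF \<phi>, where J=J]) (auto simp: freq_def)
    next
      case 2
      with s J show ?thesis by (subst dyadic_1d_shell[OF \<phi>, where J=k]) (auto simp: freq_def)
    next
      case 3
      with s show ?thesis by (subst dyadic_1d_origin[OF \<phi>(1)]) (auto simp: freq_def)
    qed
  qed
  then have "dyadic_mixed \<phi>0 m \<xi> = (\<Prod>i\<in>UNIV. if m i = ?m i then 1 else 0)"
    by (simp add: dyadic_mixed_def)
  also have "\<dots> = (if m = ?m then 1 else 0)"
    by (cases "m = ?m") (auto simp: fun_eq_iff prod_zero_iff)
  finally show ?thesis by simp
qed simp

text \<open>For \<open>j < J\<close> the coordinate \<open>i1\<close> alone places the frequency
  outside the support of the cut-off; for \<open>j \<ge> J\<close> every coordinate is small enough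
  because \<open>k \<le> J\<close>. The outcome does not depend on \<open>k\<close>, so all packets
  share the isotropic block \<open>J\<close>.\<close>

lemma dyadic_iso_FT_wave:
  fixes i1 i2 :: "'n::finite"
  assumes \<psi>: "\<And>x. (\<forall>i. \<bar>x $ i\<bar> \<le> 1) \<Longrightarrow> \<psi>0 x = 1" "\<And>x. (\<exists>i. \<bar>x $ i\<bar> \<ge> 3/2) \<Longrightarrow> \<psi>0 x = 0"
    and J: "3 \<le> k" "k \<le> J"
  shows "complex_of_real (dyadic_iso \<psi>0 j \<xi>) * FT (wave (freq i1 i2 J k) a) \<xi>
    = (if j = J then 1 else 0) * FT (wave (freq i1 i2 J k) a) \<xi>"
proof (cases "FT (wave (freq i1 i2 J k) a) \<xi> = 0")
  case False
  have s: "\<bar>\<xi> $ i - freq i1 i2 J k $ i\<bar> < 1" for i by (rule FT_wave_support[OF False])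
  have v: "\<psi>0 ((1 / 2 ^ j) *\<^sub>R \<xi>) = (if J \<le> j then 1 else 0)" for j
  proof (cases "J \<le> j")
    case True
    have "\<bar>((1 / 2 ^ j) *\<^sub>R \<xi>) $ i\<bar> \<le> 1" for i
    proof -
      have ne: "\<bar>\<xi> $ i / 2 ^ j\<bar> \<le> 1"
      proof -
        consider "i = i1" | "i \<noteq> i1" "i = i2" | "i \<noteq> i1" "i \<noteq> i2" by blast
        then show ?thesis
        proof cases
          case 1
          with s[of i] J True show ?thesis by (intro dyadic_scale(1)[of J]) (auto simp: freq_def)
        next
          case 2
          with s[of i] J True show ?thesis by (intro dyadic_scale(1)[of k]) (auto simp: freq_def)
        next
          case 3
          then have "\<bar>\<xi> $ i\<bar> \<le> 1" using s[of i] by (simp add: freq_def)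
          then show ?thesis using one_le_power[of "2::real" j] by (simp add: divide_le_eq order_trans)
        qed
      qed
      then show ?thesis by simp
    qed
    then show ?thesis using True \<psi>(1) by simp
  next
    case F: False
    have "3/2 \<le> \<bar>\<xi> $ i1 / 2 ^ j\<bar>"
      using s[of i1] J F by (intro dyadic_scale(2)[of J]) (auto simp: freq_def)
    then have "\<exists>i. \<bar>((1 / 2 ^ j) *\<^sub>R \<xi>) $ i\<bar> \<ge> 3/2" by (intro exI[of _ i1]) simp
    then show ?thesis using F \<psi>(2) by simp
  qed
  have "dyadic_iso \<psi>0 j \<xi> = (if j = J then 1 else 0)"
    using v[of 0] v[of j] v[of "j - 1"] J by (auto simp: dyadic_iso_def)
  then show ?thesis by simp
qed simp

text \<open>On each packet the multiplier acts as the scalar \<open>c k\<close>, so the multiplied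
  transform is again that of a packet sum. Dividing the coefficients by \<open>packet_const\<close>
  beforehand cancels the factor produced by \<open>IFT_FT_packet_sum\<close>.\<close>

lemma fmult_packet_sum:
  fixes w :: "nat \<Rightarrow> real^'n::finite"
  assumes m: "integrable lborel (\<lambda>\<xi>. complex_of_real (m \<xi>))" and \<phi>: "schwartz \<phi>"
    and c: "\<And>k \<xi>. k \<in> K \<Longrightarrow> complex_of_real (m \<xi>) * FT (wave (w k) (a k)) \<xi> = c k * FT (wave (w k) (a k)) \<xi>"
  shows "fmult m (\<lambda>\<phi>. \<integral>x. packet_sum K (\<lambda>k. e k / complex_of_real (packet_const TYPE('n))) w a x * \<phi> x \<partial>lborel) \<phi>
    = (\<integral>x. packet_sum K (\<lambda>k. c k * e k) w a x * \<phi> x \<partial>lborel)"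
proof -
  let ?\<kappa> = "complex_of_real (packet_const TYPE('n))"
  have \<kappa>: "?\<kappa> \<noteq> 0" using packet_const_pos[where 'n='n] by simp
  let ?g = "packet_sum K (\<lambda>k. c k * (e k / ?\<kappa>)) w a"
  have "complex_of_real (m \<xi>) * FT (packet_sum K (\<lambda>k. e k / ?\<kappa>) w a) \<xi> = FT ?g \<xi>" for \<xi>
    unfolding FT_packet_sum sum_distrib_left
  proof (intro sum.cong refl)
    fix k assume k: "k \<in> K"
    have "complex_of_real (m \<xi>) * (e k / ?\<kappa> * FT (wave (w k) (a k)) \<xi>) = e k / ?\<kappa> * (complex_of_real (m \<xi>) * FT (wave (w k) (a k)) \<xi>)"
      by (rule mult.left_commute)
    then show "complex_of_real (m \<xi>) * (e k / ?\<kappa> * FT (wave (w k) (a k)) \<xi>) = c k * (e k / ?\<kappa>) * FT (wave (w k) (a k)) \<xi>"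
      by (simp only: c[OF k] mult_ac)
  qed
  then have "fmult m (\<lambda>\<phi>. \<integral>x. packet_sum K (\<lambda>k. e k / ?\<kappa>) w a x * \<phi> x \<partial>lborel) \<phi>
    = (\<integral>x. IFT (FT ?g) x * \<phi> x \<partial>lborel)"
    unfolding fmult_def
    by (intro integral_FT_mult_IFT packet_sum_integrable schwartz_integrable[OF \<phi>] m FT_packet_sum_integrable)
  moreover have "?\<kappa> * ?g x = packet_sum K (\<lambda>k. c k * e k) w a x" for x
    unfolding packet_sum_def sum_distrib_left using \<kappa> by (intro sum.cong refl) simp
  ultimately show ?thesis by (simp only: IFT_FT_packet_sum)
qed

subsection \<open>Lower bound for the norm of a packet\<close>

lemma schwartz_measurable: "schwartz \<phi> \<Longrightarrow> \<phi> \<in> borel_measurable borel"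
  using borel_measurable_integrable[OF schwartz_integrable] by simp

definition gauss_mass :: "'a::euclidean_space itself \<Rightarrow> real" where
  "gauss_mass _ = (\<integral>x. cmod (gauss_packet 0 0 (x::'a)) \<partial>lborel)"

definition gauss_fejer_mass :: "'n::finite itself \<Rightarrow> real" where
  "gauss_fejer_mass _ = (\<integral>x. fejer_vec x * cmod (gauss_packet 0 0 x) \<partial>(lborel :: (real^'n) measure))"

lemma cmod_gauss_packet_translate: "cmod (gauss_packet w a x) = cmod (gauss_packet 0 0 (x - a))"
  by (simp add: cmod_gauss_packet)

lemma cmod_gauss_packet_le_1: "cmod (gauss_packet w a x) \<le> 1"
  by (simp add: cmod_gauss_packet)

lemma integral_cmod_gauss_packet:
  fixes w :: "'a::euclidean_space"
  shows "(\<integral>x. cmod (gauss_packet w a x) \<partial>lborel) = gauss_mass TYPE('a)"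
  unfolding gauss_mass_def cmod_gauss_packet_translate[of w a]
  by (intro integral_lborel_translate(2) integrable_norm schwartz_integrable schwartz_gauss_packet)

lemma gauss_fejer_integrable: "integrable lborel (\<lambda>x::real^'n::finite. fejer_vec x * cmod (gauss_packet 0 0 x))"
proof (rule Bochner_Integration.integrable_bound[OF fejer_vec_integrable])
  have [measurable]: "(gauss_packet 0 0 :: real^'n \<Rightarrow> complex) \<in> borel_measurable borel"
    by (rule schwartz_measurable[OF schwartz_gauss_packet])
  show "(\<lambda>x::real^'n. fejer_vec x * cmod (gauss_packet 0 0 x)) \<in> borel_measurable lborel" by measurable
  show "AE x::real^'n in lborel. norm (fejer_vec x * cmod (gauss_packet 0 0 x)) \<le> norm (fejer_vec x)"
    by (intro AE_I2) (simp add: abs_mult mult_left_le cmod_gauss_packet_le_1)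
qed

text \<open>Both factors are products over the coordinates, so the integral is a power of a
  one-dimensional one, which is positive because its integrand is bounded below on
  \<open>{1..2}\<close>.\<close>

lemma gauss_fejer_mass_pos: "gauss_fejer_mass TYPE('n::finite) > 0"
proof -
  let ?h = "\<lambda>t. fejer t * exp (- t\<^sup>2 / 2)"
  have h: "integrable lborel ?h"
    by (rule Bochner_Integration.integrable_bound[OF fejer_integrable])
       (auto simp: abs_mult fejer_nonneg intro!: AE_I2 mult_left_le)
  have eq: "complex_of_real (fejer_vec x * cmod (gauss_packet 0 0 x)) = (\<Prod>i\<in>UNIV. complex_of_real (?h (x $ i)))" for x :: "real^'n"
  proof -
    have "cmod (gauss_packet 0 0 x) = exp (\<Sum>i\<in>UNIV. - (x $ i)\<^sup>2 / 2)"
      unfolding cmod_gauss_packet power2_norm_eq_inner inner_vec_def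
      by (simp add: power2_eq_square sum_negf sum_divide_distrib)
    also have "\<dots> = (\<Prod>i\<in>UNIV. exp (- (x $ i)\<^sup>2 / 2))" by (simp add: exp_sum)
    finally show ?thesis by (simp add: fejer_vec_def prod.distrib)
  qed
  have "complex_of_real (gauss_fejer_mass TYPE('n)) = (\<integral>x. (\<Prod>i\<in>UNIV. complex_of_real (?h (x $ i))) \<partial>(lborel :: (real^'n) measure))"
    unfolding gauss_fejer_mass_def integral_complex_of_real[symmetric] eq ..
  also have "\<dots> = (\<Prod>i\<in>(UNIV::'n set). \<integral>t. complex_of_real (?h t) \<partial>lborel)"
    by (intro integral_lborel_vec_prod integrable_of_real h)
  also have "\<dots> = complex_of_real ((\<integral>t. ?h t \<partial>lborel) ^ CARD('n))"
    unfolding integral_complex_of_real by simp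
  finally have "gauss_fejer_mass TYPE('n) = (\<integral>t. ?h t \<partial>lborel) ^ CARD('n)"
    unfolding of_real_eq_iff .
  moreover have "0 < (\<integral>t. ?h t \<partial>lborel)"
  proof (rule integral_lborel_pos[OF h, of "(1 - cos 1) / 4 * exp (- 2)"])
    show "(1 - cos 1) / 4 * exp (- 2) \<le> ?h t" if t: "1 \<le> t" "t \<le> 2" for t :: real
    proof (intro mult_mono fejer_lower t)
      have "t\<^sup>2 \<le> 2\<^sup>2" using t by (intro power_mono) auto
      then show "exp (- 2) \<le> exp (- t\<^sup>2 / 2)" by simp
    qed (auto simp: fejer_nonneg)
  qed (use cos_1_less_1 in \<open>auto simp: fejer_nonneg\<close>)
  ultimately show ?thesis by simp
qed

lemma gauss_mass_pos: "gauss_mass TYPE(real^'n::finite) > 0"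
proof -
  have "gauss_fejer_mass TYPE('n) \<le> gauss_mass TYPE(real^'n)"
    unfolding gauss_fejer_mass_def gauss_mass_def
    by (intro integral_mono gauss_fejer_integrable integrable_norm schwartz_integrable schwartz_gauss_packet)
       (simp add: mult_left_le_one_le fejer_vec_nonneg fejer_vec_le_1)
  with gauss_fejer_mass_pos[where 'n='n] show ?thesis by linarith
qed

text \<open>The opposite phases cancel and leave a nonnegative integrand centred at
  \<open>a\<close>; translation then removes \<open>a\<close>. This makes the lower bound uniform
  over all packets.\<close>

lemma integral_wave_gauss_packet:
  fixes w :: "real^'n::finite"
  shows "(\<integral>x. wave w a x * gauss_packet w a x \<partial>lborel) = complex_of_real (gauss_fejer_mass TYPE('n))"
proof -
  have "gauss_packet w a x = exp (- (\<i> * complex_of_real (x \<bullet> w))) * complex_of_real (cmod (gauss_packet w a x))" for x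
  proof -
    have "gauss_packet w a x = exp (- (\<i> * complex_of_real (x \<bullet> w)) + complex_of_real (- (norm (x - a))\<^sup>2 / 2))"
      by (simp add: gauss_packet_def power2_norm_eq_inner)
    then show ?thesis unfolding cmod_gauss_packet exp_of_real[symmetric] exp_add[symmetric] .
  qed
  then have "wave w a x * gauss_packet w a x = exp (\<i> * complex_of_real (x \<bullet> w)) * exp (- (\<i> * complex_of_real (x \<bullet> w)))
      * complex_of_real (fejer_vec (x - a) * cmod (gauss_packet w a x))" for x
    unfolding wave_def of_real_mult by (metis (no_types, lifting) mult.assoc mult.left_commute)
  then have "wave w a x * gauss_packet w a x = complex_of_real (fejer_vec (x - a) * cmod (gauss_packet 0 0 (x - a)))" for x
    by (simp only: exp_minus_inverse mult_1 cmod_gauss_packet_translate[of w a])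
  then have "(\<integral>x. wave w a x * gauss_packet w a x \<partial>lborel) = complex_of_real (\<integral>x. fejer_vec (x - a) * cmod (gauss_packet 0 0 (x - a)) \<partial>lborel)"
    by (simp only: integral_complex_of_real)
  also have "(\<integral>x. fejer_vec (x - a) * cmod (gauss_packet 0 0 (x - a)) \<partial>lborel) = gauss_fejer_mass TYPE('n)"
    unfolding gauss_fejer_mass_def by (rule integral_lborel_translate(2)[OF gauss_fejer_integrable])
  finally show ?thesis .
qed

text \<open>Splitting at the level \<open>\<delta>\<close> replaces Hoelder's inequality.\<close>

lemma mult_le_level_split:
  fixes g h \<delta> P :: real
  assumes "0 < \<delta>" "1 \<le> P" "0 \<le> g" "0 \<le> h" "h \<le> 1"
  shows "g * h \<le> \<delta> * h + \<delta> powr (1 - P) * g powr P"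
proof (cases "g \<le> \<delta>")
  case True
  then show ?thesis using assms by (intro add_increasing2 mult_right_mono) auto
next
  case False
  then have "g * h \<le> g powr (1 - P) * g powr P"
    using assms by (simp add: powr_add[symmetric] mult_left_le)
  also have "\<dots> \<le> \<delta> powr (1 - P) * g powr P"
    using assms False by (intro mult_right_mono powr_mono2') auto
  finally show ?thesis using assms by (simp add: add_increasing)
qed

text \<open>A function whose pairing with a fixed bounded integrable \<open>\<phi>\<close> has
  modulus \<open>A\<close> cannot have small norm; the bound involves \<open>g\<close> only through
  \<open>A\<close>, so it applies to every representative of a distribution at once.\<close>

lemma Lp_norm_lower:
  fixes g \<phi> :: "'a::euclidean_space \<Rightarrow> complex"
  assumes p: "1 \<le> p" and g [measurable]: "g \<in> borel_measurable lborel" and \<phi>: "integrable lborel \<phi>"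
    and \<phi>1: "\<And>x. cmod (\<phi> x) \<le> 1" and G: "(\<integral>x. cmod (\<phi> x) \<partial>lborel) = G" "0 < G"
    and int: "integrable lborel (\<lambda>x. g x * \<phi> x)" and A: "cmod (\<integral>x. g x * \<phi> x \<partial>lborel) = A" "0 < A"
  shows "ennreal (if p = top then A / G
      else ((A / (2 * G)) powr (enn2real p - 1) * (A / 2)) powr (1 / enn2real p)) \<le> Lp_norm p g"
proof -
  have [measurable]: "\<phi> \<in> borel_measurable borel" using \<phi> by (auto dest!: borel_measurable_integrable)
  have [measurable]: "g \<in> borel_measurable borel" using g by simp
  have nnG: "(\<integral>\<^sup>+x. ennreal (cmod (\<phi> x)) \<partial>lborel) = ennreal G"
    using \<phi> G by (subst nn_integral_eq_integral) auto
  have A1: "ennreal A \<le> (\<integral>\<^sup>+x. ennreal (cmod (g x) * cmod (\<phi> x)) \<partial>lborel)"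
    using integral_norm_bound_ennreal[OF int] A(1) by (simp add: norm_mult)
  show ?thesis
  proof (cases "p = top")
    case True
    have "ennreal (A / G) \<le> C" if C: "AE x in lborel. ennreal (cmod (g x)) \<le> C" for C
    proof (cases "C = top")
      case False
      then obtain r where r: "C = ennreal r" "r \<ge> 0" by (cases C) auto
      have "(\<integral>\<^sup>+x. ennreal (cmod (g x) * cmod (\<phi> x)) \<partial>lborel) \<le> (\<integral>\<^sup>+x. C * ennreal (cmod (\<phi> x)) \<partial>lborel)"
        using C by (intro nn_integral_mono_AE) (auto simp: ennreal_mult elim!: eventually_mono intro!: mult_right_mono)
      also have "\<dots> = ennreal (r * G)"
        using r G(2) by (subst nn_integral_cmult) (auto simp: nnG ennreal_mult)
      finally have "ennreal A \<le> ennreal (r * G)" using A1 by (rule order_trans[rotated])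
      then have "A \<le> r * G" using r G(2) by (subst (asm) ennreal_le_iff) auto
      then show ?thesis using r G(2) by (simp add: divide_le_eq)
    qed simp
    then show ?thesis using True by (auto simp: Lp_norm_def intro!: Inf_greatest)
  next
    case False
    define P where "P = enn2real p"
    have P: "1 \<le> P" using p False unfolding P_def by (metis enn2real_1 enn2real_mono less_top)
    \<comment> \<open>With this level the term \<open>\<delta> * G\<close> of the splitting accounts
      for exactly \<open>A / 2\<close>, and the other half must come from the power
      integral.\<close>
    define \<delta> where "\<delta> = A / (2 * G)"
    have \<delta>: "0 < \<delta>" using A G by (simp add: \<delta>_def)
    define I where "I = (\<integral>\<^sup>+x. ennreal (cmod (g x) powr P) \<partial>lborel)"
    have "ennreal ((\<delta> powr (P - 1) * (A / 2)) powr (1 / P)) \<le> ennpow I (1 / P)"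
    proof (cases "I = top")
      case True
      then show ?thesis by (simp add: ennpow_def)
    next
      case False
      then obtain r where r: "I = ennreal r" "r \<ge> 0" by (cases I) auto
      have "ennreal A \<le> (\<integral>\<^sup>+x. ennreal (cmod (g x) * cmod (\<phi> x)) \<partial>lborel)" by (rule A1)
      also have "\<dots> \<le> (\<integral>\<^sup>+x. (ennreal \<delta> * ennreal (cmod (\<phi> x)) + ennreal (\<delta> powr (1 - P)) * ennreal (cmod (g x) powr P)) \<partial>lborel)"
      proof (rule nn_integral_mono)
        fix x
        have "ennreal (cmod (g x) * cmod (\<phi> x)) \<le> ennreal (\<delta> * cmod (\<phi> x) + \<delta> powr (1 - P) * cmod (g x) powr P)"
          using \<delta> P \<phi>1 by (intro ennreal_leI mult_le_level_split) auto
        then show "ennreal (cmod (g x) * cmod (\<phi> x)) \<le> ennreal \<delta> * ennreal (cmod (\<phi> x)) + ennreal (\<delta> powr (1 - P)) * ennreal (cmod (g x) powr P)"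
          using \<delta> by (simp add: ennreal_mult)
      qed
      also have "\<dots> = ennreal \<delta> * ennreal G + ennreal (\<delta> powr (1 - P)) * I"
        unfolding I_def nnG[symmetric] by (subst nn_integral_add) (auto simp: nn_integral_cmult)
      also have "\<dots> = ennreal (A / 2 + \<delta> powr (1 - P) * r)"
        using r A G \<delta> by (simp add: \<delta>_def flip: ennreal_mult ennreal_plus)
      finally have "A \<le> A / 2 + \<delta> powr (1 - P) * r" using r A by (subst (asm) ennreal_le_iff) auto
      then have "\<delta> powr (P - 1) * (A / 2) \<le> \<delta> powr (P - 1) * (\<delta> powr (1 - P) * r)"
        by (intro mult_left_mono) auto
      also have "\<dots> = r" using \<delta> by (simp add: mult.assoc[symmetric] powr_add[symmetric])
      finally show ?thesis
        using r A P by (simp add: ennpow_def) (intro ennreal_leI powr_mono2, auto)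
    qed
    then show ?thesis using False by (simp add: Lp_norm_def P_def[symmetric] I_def \<delta>_def)
  qed
qed

text \<open>Every representing function has the same pairing with the Schwartz function
  \<open>gauss_packet w a\<close>, so bounding one bounds the infimum. The constant is independent
  of \<open>w\<close> and \<open>a\<close> because the modulus of that test function is a translate
  of one fixed Gaussian.\<close>

lemma Lp_dist_wave_lower:
  assumes p: "1 \<le> p"
  obtains c where "c > 0"
    "\<And>S e w a. cmod e = 1 \<Longrightarrow> (\<And>\<phi>. schwartz \<phi> \<Longrightarrow> S \<phi> = (\<integral>x. e * wave w a x * \<phi> x \<partial>(lborel :: (real^'n::finite) measure)))
      \<Longrightarrow> ennreal c \<le> Lp_dist p S"
proof -
  define A where "A = gauss_fejer_mass TYPE('n)"
  define G where "G = gauss_mass TYPE(real^'n)"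
  have AG: "A > 0" "G > 0" unfolding A_def G_def by (rule gauss_fejer_mass_pos gauss_mass_pos)+
  define c where "c = (if p = top then A / G
      else ((A / (2 * G)) powr (enn2real p - 1) * (A / 2)) powr (1 / enn2real p))"
  have "c > 0" using AG by (simp add: c_def)
  moreover have "ennreal c \<le> Lp_dist p S"
    if e: "cmod e = 1" and S: "\<And>\<phi>. schwartz \<phi> \<Longrightarrow> S \<phi> = (\<integral>x. e * wave w a x * \<phi> x \<partial>lborel)" for S e and w a :: "real^'n"
    unfolding Lp_dist_def
  proof (rule Inf_greatest, clarify)
    fix g :: "real^'n \<Rightarrow> complex"
    assume g: "g \<in> borel_measurable lborel"
      and *: "\<forall>\<phi>. schwartz \<phi> \<longrightarrow> integrable lborel (\<lambda>x. g x * \<phi> x) \<and> S \<phi> = (\<integral>x. g x * \<phi> x \<partial>lborel)"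
    have "(\<integral>x. g x * gauss_packet w a x \<partial>lborel) = (\<integral>x. e * wave w a x * gauss_packet w a x \<partial>lborel)"
      using * S schwartz_gauss_packet by metis
    also have "\<dots> = e * complex_of_real A"
      unfolding A_def integral_wave_gauss_packet[of w a, symmetric] mult.assoc by (rule integral_mult_right_zero)
    finally have "cmod (\<integral>x. g x * gauss_packet w a x \<partial>lborel) = A" using e AG by (simp add: norm_mult)
    moreover have "integrable lborel (\<lambda>x. g x * gauss_packet w a x)" using * schwartz_gauss_packet by blast
    ultimately show "ennreal c \<le> Lp_norm p g"
      unfolding c_def
      by (intro Lp_norm_lower[OF p g schwartz_integrable[OF schwartz_gauss_packet] cmod_gauss_packet_le_1
            integral_cmod_gauss_packet[of w a, folded G_def] AG(2) _ _ AG(1)])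
  qed
  ultimately show thesis by (rule that)
qed

subsection \<open>Consequence of the embedding for packet sums\<close>

lemma ennpow_mono: "a \<le> b \<Longrightarrow> 0 \<le> r \<Longrightarrow> ennpow a r \<le> ennpow b r"
  by (cases a; cases b) (auto simp: ennpow_def top_unique intro!: ennreal_leI powr_mono2)

lemma ennpow_ennpow_inverse: "0 < r \<Longrightarrow> ennpow (ennpow a r) (1 / r) = a"
  by (cases a) (auto simp: ennpow_def powr_powr)

lemma ennpow_0 [simp]: "ennpow 0 r = 0"
  by (simp add: ennpow_def)

lemma ennpow_ennreal: "0 \<le> x \<Longrightarrow> ennpow (ennreal x) r = ennreal (x powr r)"
  by (simp add: ennpow_def)

lemma lq_norm_single:
  assumes q: "0 < q" "q < top" and a: "\<And>j. j \<noteq> J \<Longrightarrow> a j = 0"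
  shows "lq_norm q a = a J"
proof -
  define Q where "Q = enn2real q"
  have Q: "0 < Q" using q unfolding Q_def by (simp add: enn2real_positive_iff)
  have "(\<integral>\<^sup>+j. ennpow (a j) Q \<partial>count_space UNIV) = (\<integral>\<^sup>+j. ennpow (a J) Q * indicator {J} j \<partial>count_space UNIV)"
    using a by (intro nn_integral_cong) (auto split: split_indicator)
  also have "\<dots> = ennpow (a J) Q"
    by (subst nn_integral_cmult_indicator) auto
  finally show ?thesis
    using less_imp_neq[OF q(2)] Q by (simp add: lq_norm_def Q_def[symmetric] ennpow_ennpow_inverse)
qed

lemma lq_norm_lower:
  assumes q: "0 < q" "q < top" and S: "finite S" and a: "\<And>i. i \<in> S \<Longrightarrow> ennreal c \<le> a i" and c: "0 < c"
  shows "ennreal (c * real (card S) powr (1 / enn2real q)) \<le> lq_norm q a"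
proof -
  define Q where "Q = enn2real q"
  have Q: "0 < Q" using q unfolding Q_def by (simp add: enn2real_positive_iff)
  have "ennreal (c powr Q * real (card S)) = ennreal (c powr Q) * emeasure (count_space UNIV) S"
    using S by (simp add: ennreal_mult ennreal_of_nat_eq_real_of_nat)
  also have "\<dots> = (\<integral>\<^sup>+i. ennreal (c powr Q) * indicator S i \<partial>count_space UNIV)"
    by (subst nn_integral_cmult_indicator) auto
  also have "\<dots> \<le> (\<integral>\<^sup>+i. ennpow (a i) Q \<partial>count_space UNIV)"
    using ennpow_mono[OF a, of _ Q] c Q
    by (intro nn_integral_mono) (auto simp: ennpow_ennreal split: split_indicator)
  finally have "ennpow (ennreal (c powr Q * real (card S))) (1 / Q) \<le> lq_norm q a"
    using less_imp_neq[OF q(2)] Q by (simp add: lq_norm_def Q_def[symmetric] ennpow_mono)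
  moreover have "ennpow (ennreal (c powr Q * real (card S))) (1 / Q) = ennreal (c * real (card S) powr (1 / Q))"
    using c Q by (simp add: ennpow_ennreal powr_mult powr_powr)
  ultimately show ?thesis by (simp add: Q_def)
qed

lemma Lp_dist_le:
  assumes "integrable lborel g" "\<And>\<phi>. schwartz \<phi> \<Longrightarrow> S \<phi> = (\<integral>x. g x * \<phi> x \<partial>lborel)"
  shows "Lp_dist p S \<le> Lp_norm p g"
  unfolding Lp_dist_def
proof (rule Inf_lower, intro CollectI exI[of _ g] conjI allI impI)
  show "g \<in> borel_measurable lborel" using assms(1) by (rule borel_measurable_integrable)
qed (simp_all add: assms schwartz_bounded_mult_integrable)

lemma Lp_norm_0: "Lp_norm p (\<lambda>x::'a::euclidean_space. 0) = 0"
proof -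
  have "Inf {C. AE x::'a in lborel. ennreal (cmod 0) \<le> C} \<le> 0"
    by (intro Inf_lower) simp
  then show ?thesis by (simp add: Lp_norm_def)
qed

lemma mixed_index_inj:
  assumes "i1 \<noteq> i2"
  shows "inj (\<lambda>k::nat. \<lambda>i. if i = i1 then J else if i = i2 then k else (0::nat))"
  using assms by (auto simp: inj_def fun_eq_iff)

text \<open>Everything about the function spaces is condensed here into one inequality for explicit
  functions. The signs and translations stay free, since the two conclusions choose them differently
  and the signs may depend on \<open>N\<close>.\<close>

lemma embeds_packet_sum_bound:
  fixes \<psi>0 :: "(real^'n::finite) \<Rightarrow> real" and \<phi>0 :: "real \<Rightarrow> real" and i1 i2 :: 'n
  assumes \<psi>C: "C0inf \<psi>0"
    and \<psi>: "\<And>x. (\<forall>i. \<bar>x $ i\<bar> \<le> 1) \<Longrightarrow> \<psi>0 x = 1" "\<And>x. (\<exists>i. \<bar>x $ i\<bar> \<ge> 3/2) \<Longrightarrow> \<psi>0 x = 0"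
    and \<phi>C: "C0inf \<phi>0"
    and \<phi>: "\<And>t. \<bar>t\<bar> \<le> 1 \<Longrightarrow> \<phi>0 t = 1" "\<And>t. \<bar>t\<bar> \<ge> 3/2 \<Longrightarrow> \<phi>0 t = 0"
    and p: "1 \<le> p" and q: "0 < q" "q < top"
    and emb: "embeds \<psi>0 \<phi>0 0 p q" and i: "i1 \<noteq> i2"
  obtains D where "D > 0"
    "\<And>N e a. (\<And>k. cmod (e k) = 1) \<Longrightarrow> ennreal (real N powr (1 / enn2real q))
      \<le> ennreal D * Lp_norm p (packet_sum {3..<3 + N} e (freq i1 i2 (3 + N)) a)"
proof -
  obtain C where C: "\<And>T. T \<in> besov_space \<psi>0 0 p q \<Longrightarrow> mixed_norm \<phi>0 0 p q T \<le> ennreal C * besov_norm \<psi>0 0 p q T"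
    using emb unfolding embeds_def by blast
  obtain c where c: "c > 0"
    and low: "\<And>S e w a. cmod e = 1 \<Longrightarrow> (\<And>\<phi>. schwartz \<phi> \<Longrightarrow> S \<phi> = (\<integral>x. e * wave w a x * \<phi> x \<partial>(lborel :: (real^'n) measure)))
      \<Longrightarrow> ennreal c \<le> Lp_dist p S"
    using Lp_dist_wave_lower[OF p] by blast
  \<comment> \<open>The embedding constant \<open>C\<close> is an arbitrary real; the maximum with 1
    makes \<open>D\<close> positive.\<close>
  define D where "D = max C 1 / c"
  have "D > 0" using c by (simp add: D_def)
  moreover have "ennreal (real N powr (1 / enn2real q))
      \<le> ennreal D * Lp_norm p (packet_sum {3..<3 + N} e (freq i1 i2 (3 + N)) a)"
    if e: "\<And>k. cmod (e k) = 1" for N e a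
  proof -
    \<comment> \<open>Indices start at 3 because \<open>dyadic_scale\<close> needs it;
      \<open>J = 3 + N\<close> then leaves \<open>N\<close> values of \<open>k\<close> below the
      common top index.\<close>
    define J where "J = 3 + N"
    define K where "K = {3..<J}"
    define f where "f = packet_sum K e (freq i1 i2 J) a"
    define T where "T = (\<lambda>\<phi>. \<integral>x. packet_sum K (\<lambda>k. e k / complex_of_real (packet_const TYPE('n))) (freq i1 i2 J) a x * \<phi> x \<partial>lborel)"
    define idx where "idx = (\<lambda>k. \<lambda>i. if i = i1 then J else if i = i2 then k else 0)"
    show ?thesis
    \<comment> \<open>If the norm is infinite the claim is trivial because \<open>D\<close> is
      positive; finiteness is what puts \<open>T\<close> into the Besov space.\<close>
    proof (cases "Lp_norm p f = top")
      case True
      then show ?thesis using \<open>D > 0\<close> by (simp add: f_def K_def J_def ennreal_mult_top)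
    next
      case False
      have iso: "fmult (dyadic_iso \<psi>0 j) T \<phi> = (\<integral>x. packet_sum K (\<lambda>k. (if j = J then 1 else 0) * e k) (freq i1 i2 J) a x * \<phi> x \<partial>lborel)"
        if "schwartz \<phi>" for j \<phi>
        unfolding T_def
        by (intro fmult_packet_sum dyadic_iso_integrable \<psi>C that dyadic_iso_FT_wave \<psi>) (auto simp: K_def)
      have B: "besov_norm \<psi>0 0 p q T \<le> Lp_norm p f"
      proof -
        have 0: "Lp_dist p (fmult (dyadic_iso \<psi>0 j) T) = 0" if "j \<noteq> J" for j
        proof -
          have "Lp_dist p (fmult (dyadic_iso \<psi>0 j) T) \<le> Lp_norm p (\<lambda>x::real^'n. 0)"
            using that by (intro Lp_dist_le) (auto simp: iso packet_sum_def)
          then show ?thesis by (simp add: Lp_norm_0)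
        qed
        have "besov_norm \<psi>0 0 p q T = Lp_dist p (fmult (dyadic_iso \<psi>0 J) T)"
          unfolding besov_norm_def by (subst lq_norm_single[OF q, where J=J]) (auto simp: 0)
        also have "\<dots> \<le> Lp_norm p f"
          unfolding f_def by (intro Lp_dist_le packet_sum_integrable) (simp add: iso)
        finally show ?thesis .
      qed
      have "tempered T" unfolding T_def by (intro tempered_integral packet_sum_integrable)
      moreover have "besov_norm \<psi>0 0 p q T < top" using B False by (metis le_less_trans less_top)
      ultimately have "T \<in> besov_space \<psi>0 0 p q" by (simp add: besov_space_def)
      from C[OF this] have "mixed_norm \<phi>0 0 p q T \<le> ennreal C * besov_norm \<psi>0 0 p q T" .
      also have "\<dots> \<le> ennreal (max C 1) * Lp_norm p f"
        by (intro mult_mono ennreal_leI B) auto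
      finally have up: "mixed_norm \<phi>0 0 p q T \<le> ennreal (max C 1) * Lp_norm p f" .
      \<comment> \<open>By injectivity of \<open>idx\<close>, the block \<open>idx k\<close> retains
        the single packet \<open>k\<close> with its unimodular coefficient.\<close>
      have low': "ennreal c \<le> Lp_dist p (fmult (dyadic_mixed \<phi>0 (idx k)) T)" if k: "k \<in> K" for k
      proof (rule low[where e="e k" and w="freq i1 i2 J k" and a="a k"])
        fix \<phi> :: "real^'n \<Rightarrow> complex" assume "schwartz \<phi>"
        then have "fmult (dyadic_mixed \<phi>0 (idx k)) T \<phi>
          = (\<integral>x. packet_sum K (\<lambda>k'. (if idx k = idx k' then 1 else 0) * e k') (freq i1 i2 J) a x * \<phi> x \<partial>lborel)"
          unfolding T_def idx_def
          by (intro fmult_packet_sum dyadic_mixed_integrable \<phi>C dyadic_mixed_FT_wave \<phi> i) (auto simp: K_def)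
        moreover have "packet_sum K (\<lambda>k'. (if idx k = idx k' then 1 else 0) * e k') (freq i1 i2 J) a x
          = e k * wave (freq i1 i2 J k) (a k) x" for x
        proof -
          have "idx k = idx k' \<longleftrightarrow> k = k'" for k'
            using mixed_index_inj[OF i, of J] unfolding idx_def inj_def by blast
          then have "packet_sum K (\<lambda>k'. (if idx k = idx k' then 1 else 0) * e k') (freq i1 i2 J) a x
            = (\<Sum>k'\<in>K. if k = k' then e k' * wave (freq i1 i2 J k') (a k') x else 0)"
            unfolding packet_sum_def by (intro sum.cong) auto
          also have "\<dots> = e k * wave (freq i1 i2 J k) (a k) x"
            using k by (simp add: K_def)
          finally show ?thesis .
        qed
        ultimately show "fmult (dyadic_mixed \<phi>0 (idx k)) T \<phi> = (\<integral>x. e k * wave (freq i1 i2 J k) (a k) x * \<phi> x \<partial>lborel)"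
          by simp
      qed (rule e)
      have inj: "inj idx" unfolding idx_def by (rule mixed_index_inj[OF i])
      have "card (idx ` K) = N"
        using card_image[OF inj_on_subset[OF inj], of K] by (simp add: K_def J_def)
      moreover have "ennreal (c * real (card (idx ` K)) powr (1 / enn2real q)) \<le> mixed_norm \<phi>0 0 p q T"
        unfolding mixed_norm_def using low' by (intro lq_norm_lower[OF q _ _ c]) (auto simp: K_def)
      ultimately have "ennreal (c * real N powr (1 / enn2real q)) \<le> ennreal (max C 1) * Lp_norm p f"
        using up by (metis order_trans)
      then have "ennreal (1 / c) * ennreal (c * real N powr (1 / enn2real q)) \<le> ennreal (1 / c) * (ennreal (max C 1) * Lp_norm p f)"
        by (rule mult_left_mono) simp
      also have "ennreal (1 / c) * (ennreal (max C 1) * Lp_norm p f) = ennreal D * Lp_norm p f"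
        using c unfolding mult.assoc[symmetric] D_def by (subst ennreal_mult[symmetric]) auto
      also have "ennreal (1 / c) * ennreal (c * real N powr (1 / enn2real q)) = ennreal (real N powr (1 / enn2real q))"
        using c by (subst ennreal_mult[symmetric]) auto
      finally show ?thesis by (simp add: f_def K_def J_def)
    qed
  qed
  ultimately show thesis by (rule that)
qed

subsection \<open>Upper bounds for the norms of packet sums\<close>

text \<open>The terms on either side of \<open>t\<close> are compared with integer distances from
  the floor or the ceiling of \<open>t\<close>. These distances are pairwise different on each side,
  so each half is at most the full series over \<open>1 / (1 + m\<^sup>2)\<close>, uniformly in
  \<open>t\<close>.\<close>

lemma sum_inverse_1_plus_square_bounded:
  obtains A :: real where "A > 0" "\<And>K t. finite K \<Longrightarrow> (\<Sum>k\<in>K. inverse (1 + (t - real k)\<^sup>2)) \<le> A"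
proof -
  define s where "s m = inverse (1 + (real m)\<^sup>2)" for m :: nat
  have s0: "0 \<le> s m" for m by (simp add: s_def)
  have "summable s"
  proof (rule summable_comparison_test'[OF inverse_power_summable[of 2], of 1])
    show "norm (s m) \<le> inverse ((real m)\<^sup>2)" if "1 \<le> m" for m
      using that by (auto simp: s_def intro!: le_imp_inverse_le)
  qed simp
  have S: "sum (\<lambda>k. s (h k)) L \<le> suminf s" if "finite L" "inj_on h L" for h and L :: "nat set"
    using sum_le_suminf[OF \<open>summable s\<close>, of "h ` L"] that s0 by (simp add: sum.reindex)
  have "(\<Sum>k\<in>K. inverse (1 + (t - real k)\<^sup>2)) \<le> 2 * suminf s + 1" if K: "finite K" for K t
  proof -
    define K1 where "K1 = {k\<in>K. real k \<le> t}"
    define K2 where "K2 = {k\<in>K. t < real k}"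
    have "(\<Sum>k\<in>K1. inverse (1 + (t - real k)\<^sup>2)) \<le> (\<Sum>k\<in>K1. s (nat \<lfloor>t\<rfloor> - k))"
    proof (rule sum_mono)
      fix k assume "k \<in> K1"
      then have k: "real k \<le> t" by (simp add: K1_def)
      then have "real (nat \<lfloor>t\<rfloor> - k) \<le> t - real k" by linarith
      then have "(real (nat \<lfloor>t\<rfloor> - k))\<^sup>2 \<le> (t - real k)\<^sup>2" by (intro power_mono) auto
      then show "inverse (1 + (t - real k)\<^sup>2) \<le> s (nat \<lfloor>t\<rfloor> - k)"
        unfolding s_def by (intro le_imp_inverse_le) (auto intro: add_pos_nonneg)
    qed
    also have "\<dots> \<le> suminf s"
    proof (rule S)
      have "k \<le> nat \<lfloor>t\<rfloor>" if "k \<in> K1" for k using that by (simp add: K1_def) linarith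
      then show "inj_on (\<lambda>k. nat \<lfloor>t\<rfloor> - k) K1" by (intro inj_onI) (metis diff_diff_cancel)
    qed (use K in \<open>simp add: K1_def\<close>)
    finally have 1: "(\<Sum>k\<in>K1. inverse (1 + (t - real k)\<^sup>2)) \<le> suminf s" .
    have "(\<Sum>k\<in>K2. inverse (1 + (t - real k)\<^sup>2)) \<le> (\<Sum>k\<in>K2. s (k - nat \<lceil>t\<rceil>))"
    proof (rule sum_mono)
      fix k assume "k \<in> K2"
      then have k: "t < real k" by (simp add: K2_def)
      then have "real (k - nat \<lceil>t\<rceil>) \<le> real k - t" by linarith
      then have "(real (k - nat \<lceil>t\<rceil>))\<^sup>2 \<le> (real k - t)\<^sup>2" by (intro power_mono) auto
      then show "inverse (1 + (t - real k)\<^sup>2) \<le> s (k - nat \<lceil>t\<rceil>)"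
        unfolding s_def power2_commute[of t] by (intro le_imp_inverse_le) (auto intro: add_pos_nonneg)
    qed
    also have "\<dots> \<le> suminf s"
    proof (rule S)
      have "nat \<lceil>t\<rceil> \<le> k" if "k \<in> K2" for k using that by (simp add: K2_def)
      then show "inj_on (\<lambda>k. k - nat \<lceil>t\<rceil>) K2" by (intro inj_onI) (metis le_add_diff_inverse)
    qed (use K in \<open>simp add: K2_def\<close>)
    finally have 2: "(\<Sum>k\<in>K2. inverse (1 + (t - real k)\<^sup>2)) \<le> suminf s" .
    have "K = K1 \<union> K2" "K1 \<inter> K2 = {}" by (auto simp: K1_def K2_def)
    then have "(\<Sum>k\<in>K. inverse (1 + (t - real k)\<^sup>2)) = (\<Sum>k\<in>K1. inverse (1 + (t - real k)\<^sup>2)) + (\<Sum>k\<in>K2. inverse (1 + (t - real k)\<^sup>2))"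
      using K by (simp add: sum.union_disjoint)
    then show ?thesis using 1 2 by linarith
  qed
  \<comment> \<open>The added 1 yields strict positivity from nonnegativity of the series.\<close>
  moreover have "2 * suminf s + 1 > 0" using suminf_nonneg[OF \<open>summable s\<close> s0] by linarith
  ultimately show thesis using that by blast
qed

lemma Lp_norm_le:
  assumes p: "1 \<le> p" "p < top" and B: "0 \<le> B"
    "(\<integral>\<^sup>+x. ennreal (cmod (f x) powr enn2real p) \<partial>lborel) \<le> ennreal B"
  shows "Lp_norm p f \<le> ennreal (B powr (1 / enn2real p))"
  using less_imp_neq[OF p(2)] ennpow_mono[OF B(2), of "1 / enn2real p"] B(1)
  by (simp add: Lp_norm_def ennpow_ennreal)

text \<open>Only the factor in coordinate \<open>i2\<close> sees the translation and supplies the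
  quadratic decay; the remaining factors are bounded by 1.\<close>

lemma sum_fejer_vec_translates_bounded:
  fixes i2 :: "'n::finite"
  obtains A where "A > 0" "\<And>K x. finite K \<Longrightarrow> (\<Sum>k\<in>K. fejer_vec (x - axis i2 (real k))) \<le> A"
proof -
  obtain A where A: "A > 0" "\<And>K t. finite K \<Longrightarrow> (\<Sum>k\<in>K. inverse (1 + (t - real k)\<^sup>2)) \<le> A"
    using sum_inverse_1_plus_square_bounded by blast
  have *: "fejer_vec (x - axis i2 (real k)) \<le> 4 * inverse (1 + (x $ i2 - real k)\<^sup>2)" for x :: "real^'n" and k
  proof -
    have "fejer_vec (x - axis i2 (real k)) = fejer (x $ i2 - real k) * (\<Prod>i\<in>UNIV - {i2}. fejer ((x - axis i2 (real k)) $ i))"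
      unfolding fejer_vec_def by (subst prod.remove[of _ i2]) (auto simp: axis_def)
    also have "\<dots> \<le> fejer (x $ i2 - real k) * 1"
    proof (intro mult_left_mono prod_le_1 conjI fejer_nonneg)
      show "fejer t \<le> 1" for t using fejer_le_half[of t] by linarith
    qed
    also have "\<dots> \<le> 4 * inverse (1 + (x $ i2 - real k)\<^sup>2)" using fejer_le by simp
    finally show ?thesis .
  qed
  have "(\<Sum>k\<in>K. fejer_vec (x - axis i2 (real k))) \<le> 4 * A" if "finite K" for K and x :: "real^'n"
  proof -
    have "(\<Sum>k\<in>K. fejer_vec (x - axis i2 (real k))) \<le> (\<Sum>k\<in>K. 4 * inverse (1 + (x $ i2 - real k)\<^sup>2))"
      by (intro sum_mono *)
    then show ?thesis using A(2)[OF that, of "x $ i2"] unfolding sum_distrib_left[symmetric] by linarith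
  qed
  with A(1) show thesis by (intro that[of "4 * A"]) auto
qed

lemma cmod_packet_sum_le:
  assumes "\<And>k. cmod (e k) = 1"
  shows "cmod (packet_sum K e w a x) \<le> (\<Sum>k\<in>K. fejer_vec (x - a k))"
  unfolding packet_sum_def
  by (rule order_trans[OF norm_sum]) (simp add: norm_mult cmod_wave assms)

definition fejer_vec_mass :: "'n::finite itself \<Rightarrow> real" where
  "fejer_vec_mass _ = (\<integral>x. fejer_vec x \<partial>(lborel :: (real^'n) measure))"

lemma fejer_vec_mass_nonneg: "0 \<le> fejer_vec_mass TYPE('n::finite)"
  unfolding fejer_vec_mass_def by (intro Bochner_Integration.integral_nonneg fejer_vec_nonneg)

text \<open>Unit spacing is enough: the sum \<open>F\<close> of the envelopes is bounded by some
  \<open>A\<close> uniformly in \<open>N\<close>, so \<open>F powr P\<close> is at most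
  \<open>A powr (P - 1) * F\<close>, whose integral is linear in \<open>N\<close>. For
  \<open>p = top\<close> the bound \<open>A\<close> itself gives exponent 0.\<close>

lemma Lp_norm_translated_packets:
  fixes i2 :: "'n::finite"
  assumes p: "1 \<le> p"
  obtains B where "B \<ge> 0"
    "\<And>N e w. (\<And>k. cmod (e k) = 1) \<Longrightarrow>
      Lp_norm p (packet_sum {3..<3 + N} e w (\<lambda>k. axis i2 (real k)))
        \<le> ennreal (B * real N powr (if p = top then 0 else 1 / enn2real p))"
proof -
  obtain A where A: "A > 0" "\<And>K x. finite K \<Longrightarrow> (\<Sum>k\<in>K. fejer_vec (x - axis i2 (real k))) \<le> A"
    using sum_fejer_vec_translates_bounded by blast
  define M where "M = fejer_vec_mass TYPE('n)"
  have M: "M \<ge> 0" unfolding M_def by (rule fejer_vec_mass_nonneg)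
  show thesis
  proof (cases "p = top")
    case True
    have "Lp_norm p (packet_sum {3..<3 + N} e w (\<lambda>k. axis i2 (real k))) \<le> ennreal (A * real N powr 0)"
      if e: "\<And>k. cmod (e k) = 1" for N e w
    \<comment> \<open>The case \<open>N = 0\<close> is separate because \<open>0 powr 0 = 0\<close>,
      so the right-hand side vanishes.\<close>
    proof (cases "N = 0")
      case True
      then have "packet_sum {3..<3 + N} e w (\<lambda>k. axis i2 (real k)) = (\<lambda>x. 0)"
        by (simp add: packet_sum_def fun_eq_iff)
      then show ?thesis by (simp add: Lp_norm_0)
    next
      case False
      have "ennreal (cmod (packet_sum {3..<3 + N} e w (\<lambda>k. axis i2 (real k)) x)) \<le> ennreal A" for x
        by (intro ennreal_leI order_trans[OF cmod_packet_sum_le[OF e] A(2)]) simp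
      then show ?thesis using True False by (simp add: Lp_norm_def) (intro Inf_lower, simp)
    qed
    then show thesis using True A(1) by (intro that[of A]) auto
  next
    case False
    then have ptop: "p < top" by (simp add: less_top)
    define P where "P = enn2real p"
    have P: "1 \<le> P" using p ptop unfolding P_def by (metis enn2real_1 enn2real_mono)
    have "Lp_norm p (packet_sum {3..<3 + N} e w (\<lambda>k. axis i2 (real k))) \<le> ennreal ((A powr (P - 1) * M) powr (1 / P) * real N powr (1 / P))"
      if e: "\<And>k. cmod (e k) = 1" for N e w
    proof -
      let ?f = "packet_sum {3..<3 + N} e w (\<lambda>k. axis i2 (real k))"
      let ?F = "\<lambda>x. \<Sum>k\<in>{3..<3 + N}. fejer_vec (x - axis i2 (real k) :: real^'n)"
      have int: "integrable lborel (\<lambda>x. fejer_vec (x - axis i2 (real k) :: real^'n))" for k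
        by (rule integral_lborel_translate(1)[OF fejer_vec_integrable])
      have "(\<integral>\<^sup>+x. ennreal (cmod (?f x) powr P) \<partial>lborel) \<le> (\<integral>\<^sup>+x. ennreal (A powr (P - 1) * ?F x) \<partial>lborel)"
      proof (intro nn_integral_mono ennreal_leI)
        fix x
        have F0: "0 \<le> ?F x" by (intro sum_nonneg fejer_vec_nonneg)
        have "cmod (?f x) powr P \<le> ?F x powr P"
          using P by (intro powr_mono2 cmod_packet_sum_le e) auto
        also have "\<dots> = ?F x powr (P - 1) * ?F x"
          using powr_mult_base[OF F0, of "P - 1"] by (simp add: mult.commute)
        also have "\<dots> \<le> A powr (P - 1) * ?F x"
          using P F0 A(2)[of "{3..<3 + N}" x] by (intro mult_right_mono powr_mono2) auto
        finally show "cmod (?f x) powr P \<le> A powr (P - 1) * ?F x" .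
      qed
      also have "\<dots> = ennreal (\<integral>x. A powr (P - 1) * ?F x \<partial>lborel)"
        by (intro nn_integral_eq_integral integrable_mult_right Bochner_Integration.integrable_sum int)
           (auto intro!: AE_I2 mult_nonneg_nonneg sum_nonneg fejer_vec_nonneg)
      also have "(\<integral>x. A powr (P - 1) * ?F x \<partial>lborel) = A powr (P - 1) * M * real N"
      proof -
        have "(\<integral>x. ?F x \<partial>lborel) = (\<Sum>k\<in>{3..<3 + N}. \<integral>x. fejer_vec (x - axis i2 (real k)) \<partial>lborel)"
          by (intro Bochner_Integration.integral_sum int)
        also have "\<dots> = real N * M"
          by (simp add: integral_lborel_translate(2)[OF fejer_vec_integrable] M_def fejer_vec_mass_def)
        finally show ?thesis by simp
      qed
      finally have "(\<integral>\<^sup>+x. ennreal (cmod (?f x) powr P) \<partial>lborel) \<le> ennreal (A powr (P - 1) * M * real N)" .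
      then have "Lp_norm p ?f \<le> ennreal ((A powr (P - 1) * M * real N) powr (1 / P))"
        using M unfolding P_def by (intro Lp_norm_le p ptop) auto
      then show ?thesis using M by (simp add: powr_mult)
    qed
    then show thesis using False by (intro that[of "(A powr (P - 1) * M) powr (1 / P)"]) (auto simp: P_def)
  qed
qed

text \<open>The signs are chosen greedily. For a new exponential \<open>u\<close> of modulus 1, the
  parallelogram law says that the average of the squares of \<open>g + u\<close> and
  \<open>g - u\<close> is the square of \<open>g\<close> plus 1; after weighted integration one of
  the two signs increases the integral by at most \<open>fejer_vec_mass\<close>.\<close>

lemma exists_signs_L2:
  fixes w :: "nat \<Rightarrow> real^'n::finite"
  assumes "finite K"
  shows "\<exists>e. (\<forall>k. cmod (e k) = 1) \<and>
    (\<integral>x. fejer_vec x * (cmod (\<Sum>k\<in>K. e k * exp (\<i> * complex_of_real (x \<bullet> w k))))\<^sup>2 \<partial>lborel)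
      \<le> real (card K) * fejer_vec_mass TYPE('n)"
  using assms
proof induction
  case empty
  show ?case by (intro exI[of _ "\<lambda>_. 1"]) auto
next
  case (insert k K)
  let ?M = "fejer_vec_mass TYPE('n)"
  obtain e where e: "\<And>k. cmod (e k) = 1"
    and IH: "(\<integral>x. fejer_vec x * (cmod (\<Sum>k\<in>K. e k * exp (\<i> * complex_of_real (x \<bullet> w k))))\<^sup>2 \<partial>lborel) \<le> real (card K) * ?M"
    using insert.IH by blast
  define g where "g x = (\<Sum>k\<in>K. e k * exp (\<i> * complex_of_real (x \<bullet> w k)))" for x
  define u where "u x = exp (\<i> * complex_of_real (x \<bullet> w k))" for x
  have [measurable]: "g \<in> borel_measurable borel" "u \<in> borel_measurable borel"
    unfolding g_def[abs_def] u_def[abs_def] by (intro borel_measurable_continuous_onI continuous_intros)+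
  have g: "cmod (g x) \<le> real (card K)" for x
    unfolding g_def by (rule order_trans[OF norm_sum]) (simp add: norm_mult e)
  have u: "cmod (u x) = 1" for x by (simp add: u_def)
  have int: "integrable lborel (\<lambda>x. fejer_vec x * (cmod (h x))\<^sup>2)"
    if [measurable]: "h \<in> borel_measurable borel" and h: "\<And>x. cmod (h x) \<le> B" for h and B :: real
  proof (rule Bochner_Integration.integrable_bound[OF integrable_mult_left[OF fejer_vec_integrable, of "B\<^sup>2"]])
    have "(cmod (h x))\<^sup>2 \<le> B\<^sup>2" for x using h[of x] by (intro power_mono) auto
    then show "AE x in lborel. norm (fejer_vec x * (cmod (h x))\<^sup>2) \<le> norm (fejer_vec x * B\<^sup>2)"
      by (intro AE_I2) (simp add: abs_mult mult_left_mono)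
  qed measurable
  have b: "cmod (g x + u x) \<le> real (card K) + 1" "cmod (g x - u x) \<le> real (card K) + 1" for x
    using norm_triangle_ineq[of "g x" "u x"] norm_triangle_ineq4[of "g x" "u x"] g[of x] u[of x] by linarith+
  have par: "(cmod (g x + u x))\<^sup>2 + (cmod (g x - u x))\<^sup>2 = 2 * (cmod (g x))\<^sup>2 + 2" for x
    using u[of x] unfolding cmod_power2
    by (simp add: power2_eq_square algebra_simps) (simp add: cmod_def power2_eq_square)
  have "(\<integral>x. fejer_vec x * (cmod (g x + u x))\<^sup>2 \<partial>lborel) + (\<integral>x. fejer_vec x * (cmod (g x - u x))\<^sup>2 \<partial>lborel)
    = (\<integral>x. 2 * (fejer_vec x * (cmod (g x))\<^sup>2) + 2 * fejer_vec x \<partial>lborel)"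
  proof -
    have "fejer_vec x * (cmod (g x + u x))\<^sup>2 + fejer_vec x * (cmod (g x - u x))\<^sup>2 = 2 * (fejer_vec x * (cmod (g x))\<^sup>2) + 2 * fejer_vec x" for x
      unfolding distrib_left[symmetric] par by (simp add: algebra_simps)
    then show ?thesis
      by (subst Bochner_Integration.integral_add[symmetric]) (auto intro: int b)
  qed
  also have "\<dots> = 2 * (\<integral>x. fejer_vec x * (cmod (g x))\<^sup>2 \<partial>lborel) + 2 * ?M"
    unfolding fejer_vec_mass_def
    by (subst Bochner_Integration.integral_add) (auto intro: integrable_mult_right int g fejer_vec_integrable)
  also have "\<dots> \<le> 2 * (real (card (insert k K)) * ?M)"
    using IH insert.hyps by (simp add: g_def algebra_simps)
  finally have "(\<integral>x. fejer_vec x * (cmod (g x + u x))\<^sup>2 \<partial>lborel) \<le> real (card (insert k K)) * ?M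
     \<or> (\<integral>x. fejer_vec x * (cmod (g x - u x))\<^sup>2 \<partial>lborel) \<le> real (card (insert k K)) * ?M"
    by linarith
  then have "\<exists>\<epsilon>::complex. (\<epsilon> = 1 \<or> \<epsilon> = - 1) \<and>
      (\<integral>x. fejer_vec x * (cmod (g x + \<epsilon> * u x))\<^sup>2 \<partial>lborel) \<le> real (card (insert k K)) * ?M"
  proof (elim disjE)
    assume "(\<integral>x. fejer_vec x * (cmod (g x + u x))\<^sup>2 \<partial>lborel) \<le> real (card (insert k K)) * ?M"
    then show ?thesis by (intro exI[of _ 1]) simp
  next
    assume "(\<integral>x. fejer_vec x * (cmod (g x - u x))\<^sup>2 \<partial>lborel) \<le> real (card (insert k K)) * ?M"
    then show ?thesis by (intro exI[of _ "- 1"]) simp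
  qed
  then obtain \<epsilon> :: complex where \<epsilon>: "\<epsilon> = 1 \<or> \<epsilon> = - 1"
    and le: "(\<integral>x. fejer_vec x * (cmod (g x + \<epsilon> * u x))\<^sup>2 \<partial>lborel) \<le> real (card (insert k K)) * ?M"
    by blast
  have "(\<Sum>l\<in>insert k K. (e(k := \<epsilon>)) l * exp (\<i> * complex_of_real (x \<bullet> w l))) = g x + \<epsilon> * u x" for x
  proof -
    have "(\<Sum>l\<in>K. (e(k := \<epsilon>)) l * exp (\<i> * complex_of_real (x \<bullet> w l))) = g x"
      unfolding g_def using insert.hyps by (intro sum.cong) auto
    then show ?thesis using insert.hyps by (simp add: u_def)
  qed
  with le have "(\<integral>x. fejer_vec x * (cmod (\<Sum>l\<in>insert k K. (e(k := \<epsilon>)) l * exp (\<i> * complex_of_real (x \<bullet> w l))))\<^sup>2 \<partial>lborel)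
    \<le> real (card (insert k K)) * ?M" by (simp only:)
  moreover have "\<forall>l. cmod ((e(k := \<epsilon>)) l) = 1" using e \<epsilon> by auto
  ultimately show ?case by blast
qed

text \<open>Serves to deduce an \<open>L\<^sub>p\<close> bound from the weighted square bound when
  the exponent is at most 2, in place of Hoelder's inequality.\<close>

lemma powr_le_1_plus_square:
  fixes s P :: real
  assumes "0 \<le> s" "0 \<le> P" "P \<le> 2"
  shows "s powr P \<le> 1 + s\<^sup>2"
proof (cases "s \<le> 1")
  case True
  then have "s powr P \<le> 1 powr P" using assms by (intro powr_mono2) auto
  then show ?thesis by (simp add: add_increasing2)
next
  case False
  then have "s powr P \<le> s powr 2" using assms by (intro powr_mono) auto
  then show ?thesis using False by (simp add: powr_numeral)
qed

lemma Lp_norm_signed_packets: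
  assumes p: "1 \<le> p" "p < 2"
  obtains B where "B \<ge> 0"
    "\<And>N (w :: nat \<Rightarrow> real^'n::finite). \<exists>e. (\<forall>k. cmod (e k) = 1) \<and>
      Lp_norm p (packet_sum {3..<3 + N} e w (\<lambda>k. 0)) \<le> ennreal (B * real N powr (1 / 2))"
proof -
  have ptop: "p < top" using p(2) by (rule less_le_trans) simp
  define P where "P = enn2real p"
  have P: "1 \<le> P" using p ptop unfolding P_def by (metis enn2real_1 enn2real_mono)
  have "P \<le> enn2real 2" unfolding P_def using p(2) by (intro enn2real_mono) (auto simp: less_imp_le)
  then have P2: "P \<le> 2" by simp
  define M where "M = fejer_vec_mass TYPE('n)"
  have M: "M \<ge> 0" unfolding M_def by (rule fejer_vec_mass_nonneg)
  have "\<exists>e. (\<forall>k. cmod (e k) = 1) \<and>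
      Lp_norm p (packet_sum {3..<3 + N} e w (\<lambda>k. 0)) \<le> ennreal ((2 * M) powr (1 / P) * real N powr (1 / 2))"
    for N and w :: "nat \<Rightarrow> real^'n"
  proof (cases "N = 0")
    case True
    then have "packet_sum {3..<3 + N} (\<lambda>_. 1) w (\<lambda>k. 0) = (\<lambda>x. 0)"
      by (simp add: packet_sum_def fun_eq_iff)
    then show ?thesis by (intro exI[of _ "\<lambda>_. 1"]) (simp add: Lp_norm_0)
  next
    case False
    then have N: "real N > 0" by simp
    obtain e where e: "\<And>k. cmod (e k) = 1"
      and L2: "(\<integral>x. fejer_vec x * (cmod (\<Sum>k\<in>{3..<3 + N}. e k * exp (\<i> * complex_of_real (x \<bullet> w k))))\<^sup>2 \<partial>lborel) \<le> real N * M"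
      using exists_signs_L2[of "{3..<3 + N}" w] unfolding M_def by auto
    define g where "g x = (\<Sum>k\<in>{3..<3 + N}. e k * exp (\<i> * complex_of_real (x \<bullet> w k)))" for x
    let ?f = "packet_sum {3..<3 + N} e w (\<lambda>k. 0)"
    have f: "cmod (?f x) = cmod (g x) * fejer_vec x" for x
    proof -
      have "?f x = g x * complex_of_real (fejer_vec x)"
        by (simp add: packet_sum_def wave_def g_def sum_distrib_right mult.assoc)
      then show ?thesis by (simp add: norm_mult fejer_vec_nonneg)
    qed
    have [measurable]: "g \<in> borel_measurable borel"
      unfolding g_def[abs_def] by (intro borel_measurable_continuous_onI continuous_intros)
    have gN: "cmod (g x) \<le> real N" for x
      unfolding g_def by (rule order_trans[OF norm_sum]) (simp add: norm_mult e)
    have int: "integrable lborel (\<lambda>x. fejer_vec x * (cmod (g x))\<^sup>2)"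
    proof (rule Bochner_Integration.integrable_bound[OF integrable_mult_left[OF fejer_vec_integrable, of "(real N)\<^sup>2"]])
      have "(cmod (g x))\<^sup>2 \<le> (real N)\<^sup>2" for x using gN[of x] by (intro power_mono) auto
      then show "AE x in lborel. norm (fejer_vec x * (cmod (g x))\<^sup>2) \<le> norm (fejer_vec x * (real N)\<^sup>2)"
        by (intro AE_I2) (simp add: abs_mult mult_left_mono)
    qed measurable
    have "(\<integral>\<^sup>+x. ennreal (cmod (?f x) powr P) \<partial>lborel)
      \<le> (\<integral>\<^sup>+x. ennreal (real N powr (P / 2) * (fejer_vec x + fejer_vec x * (cmod (g x))\<^sup>2 / real N)) \<partial>lborel)"
    proof (intro nn_integral_mono ennreal_leI)
      fix x :: "real^'n"
      \<comment> \<open>As \<open>fejer_vec\<close> is at most 1 and \<open>P \<ge> 1\<close>, its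
        power may be replaced by the weight that occurs in the square bound.\<close>
      have v: "fejer_vec x powr P \<le> fejer_vec x"
        using powr_mono'[OF P fejer_vec_nonneg fejer_vec_le_1, of x] fejer_vec_nonneg[of x] by simp
      \<comment> \<open>Normalisation by the square root of \<open>N\<close>, the size of
        \<open>g\<close> in the weighted square mean; the weighted integral of
        \<open>1 + s\<^sup>2\<close> is then at most \<open>2 * M\<close>.\<close>
      define s where "s = cmod (g x) / sqrt (real N)"
      have "cmod (g x) powr P = (sqrt (real N) * s) powr P" using N by (simp add: s_def)
      also have "\<dots> = real N powr (P / 2) * s powr P"
        unfolding powr_mult using N by (simp add: powr_half_sqrt[symmetric] powr_powr)
      also have "\<dots> \<le> real N powr (P / 2) * (1 + s\<^sup>2)"
        using P P2 by (intro mult_left_mono powr_le_1_plus_square) (auto simp: s_def)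
      also have "s\<^sup>2 = (cmod (g x))\<^sup>2 / real N" using N by (simp add: s_def power_divide)
      finally have gp: "cmod (g x) powr P \<le> real N powr (P / 2) * (1 + (cmod (g x))\<^sup>2 / real N)" .
      have "cmod (?f x) powr P = cmod (g x) powr P * fejer_vec x powr P"
        unfolding f by (rule powr_mult)
      also have "\<dots> \<le> (real N powr (P / 2) * (1 + (cmod (g x))\<^sup>2 / real N)) * fejer_vec x"
        using gp v by (intro mult_mono) auto
      finally show "cmod (?f x) powr P \<le> real N powr (P / 2) * (fejer_vec x + fejer_vec x * (cmod (g x))\<^sup>2 / real N)"
        by (simp add: algebra_simps)
    qed
    also have "\<dots> = ennreal (\<integral>x. real N powr (P / 2) * (fejer_vec x + fejer_vec x * (cmod (g x))\<^sup>2 / real N) \<partial>lborel)"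
      using int
      by (intro nn_integral_eq_integral integrable_mult_right Bochner_Integration.integrable_add fejer_vec_integrable integrable_divide)
         (auto intro!: AE_I2 mult_nonneg_nonneg add_nonneg_nonneg divide_nonneg_nonneg fejer_vec_nonneg)
    also have "(\<integral>x. real N powr (P / 2) * (fejer_vec x + fejer_vec x * (cmod (g x))\<^sup>2 / real N) \<partial>lborel)
      = real N powr (P / 2) * (M + (\<integral>x. fejer_vec x * (cmod (g x))\<^sup>2 \<partial>lborel) / real N)"
      unfolding integral_mult_right_zero M_def fejer_vec_mass_def
      using int by (subst Bochner_Integration.integral_add) (auto intro: fejer_vec_integrable)
    also have "\<dots> \<le> real N powr (P / 2) * (2 * M)"
    proof (rule mult_left_mono)
      have "(\<integral>x. fejer_vec x * (cmod (g x))\<^sup>2 \<partial>lborel) \<le> M * real N" using L2 by (simp add: g_def mult.commute)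
      then have "(\<integral>x. fejer_vec x * (cmod (g x))\<^sup>2 \<partial>lborel) / real N \<le> M" using N by (simp add: pos_divide_le_eq)
      then show "M + (\<integral>x. fejer_vec x * (cmod (g x))\<^sup>2 \<partial>lborel) / real N \<le> 2 * M" by simp
    qed simp
    finally have "(\<integral>\<^sup>+x. ennreal (cmod (?f x) powr P) \<partial>lborel) \<le> ennreal (real N powr (P / 2) * (2 * M))"
      by (simp add: ennreal_leI)
    then have "Lp_norm p ?f \<le> ennreal ((real N powr (P / 2) * (2 * M)) powr (1 / P))"
      using M unfolding P_def by (intro Lp_norm_le p ptop) auto
    also have "(real N powr (P / 2) * (2 * M)) powr (1 / P) = (2 * M) powr (1 / P) * real N powr (1 / 2)"
      using M P by (simp add: powr_mult powr_powr)
    finally show ?thesis using e by blast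
  qed
  then show thesis by (intro that[of "(2 * M) powr (1 / P)"]) auto
qed

section \<open>Comparison of growth exponents and conclusion\<close>

lemma powr_growth_exponent_le:
  fixes \<alpha> \<beta> C :: real
  assumes "\<And>N::nat. real N powr \<alpha> \<le> C * real N powr \<beta>"
  shows "\<alpha> \<le> \<beta>"
proof (rule ccontr)
  assume "\<not> \<alpha> \<le> \<beta>"
  then have \<gamma>: "0 < \<alpha> - \<beta>" by simp
  \<comment> \<open>Beyond this threshold \<open>N powr (\<alpha> - \<beta>)\<close> exceeds
    \<open>C\<close>; the absolute value covers negative \<open>C\<close>, and the maximum with 1
    keeps \<open>N\<close> positive.\<close>
  obtain N :: nat where N: "max 1 (\<bar>C\<bar> powr (1 / (\<alpha> - \<beta>))) < real N"
    using reals_Archimedean2 by blast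
  then have "(\<bar>C\<bar> powr (1 / (\<alpha> - \<beta>))) powr (\<alpha> - \<beta>) < real N powr (\<alpha> - \<beta>)"
    using \<gamma> by (intro powr_less_mono2) auto
  then have "C < real N powr (\<alpha> - \<beta>)" using \<gamma> by (simp add: powr_powr split: if_splits)
  then have "C * real N powr \<beta> < real N powr (\<alpha> - \<beta>) * real N powr \<beta>"
    using N by (intro mult_strict_right_mono) auto
  also have "\<dots> = real N powr \<alpha>" by (simp add: powr_add[symmetric])
  finally show False using assms[of N] by linarith
qed

lemma ennreal_powr_bound:
  assumes "ennreal x \<le> ennreal D * L" "L \<le> ennreal (B * y)" "0 \<le> D" "0 \<le> B" "0 \<le> y"
  shows "x \<le> (D * B) * y"
proof -
  have "ennreal x \<le> ennreal D * ennreal (B * y)"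
    using assms(1) mult_left_mono[OF assms(2), of "ennreal D"] by (meson order_trans zero_le)
  also have "\<dots> = ennreal (D * B * y)" using assms by (simp add: ennreal_mult mult.assoc)
  finally show ?thesis using assms by (simp add: ennreal_le_iff)
qed

theorem lemma4p11:
  fixes \<psi>0 :: "(real^'n::finite) \<Rightarrow> real" and \<phi>0 :: "real \<Rightarrow> real"
    and p q :: ennreal
  assumes "CARD('n) \<ge> 2"
    and "C0inf \<psi>0"
    and "\<And>x. (\<forall>i. \<bar>x $ i\<bar> \<le> 1) \<Longrightarrow> \<psi>0 x = 1"
    and "\<And>x. (\<exists>i. \<bar>x $ i\<bar> \<ge> 3/2) \<Longrightarrow> \<psi>0 x = 0"
    and "C0inf \<phi>0"
    and "\<And>t. \<bar>t\<bar> \<le> 1 \<Longrightarrow> \<phi>0 t = 1"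
    and "\<And>t. \<bar>t\<bar> \<ge> 3/2 \<Longrightarrow> \<phi>0 t = 0"
    and "1 < p" and "0 < q"
    and "embeds \<psi>0 \<phi>0 0 p q"
  shows "q \<ge> max p 2"
proof (cases "q = top")
  case False
  then have qtop: "q < top" by (simp add: less_top)
  define Q where "Q = enn2real q"
  have Q: "0 < Q" and qQ: "q = ennreal Q"
    using \<open>0 < q\<close> qtop by (simp_all add: Q_def enn2real_positive_iff)
  have p1: "1 \<le> p" using \<open>1 < p\<close> by (rule less_imp_le)
  obtain i1 i2 :: 'n where i: "i1 \<noteq> i2"
    using assms(1) card_le_Suc0_iff_eq[of "UNIV :: 'n set"] by auto
  obtain D where D: "D > 0"
    and key: "\<And>N e a. (\<And>k. cmod (e k) = 1) \<Longrightarrow> ennreal (real N powr (1 / Q))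
      \<le> ennreal D * Lp_norm p (packet_sum {3..<3 + N} e (freq i1 i2 (3 + N)) a)"
    using embeds_packet_sum_bound[OF assms(2,3,4,5,6,7) p1 \<open>0 < q\<close> qtop assms(10) i]
    unfolding Q_def by blast
  obtain A where A: "A \<ge> 0"
    and upA: "\<And>N e w. (\<And>k. cmod (e k) = 1) \<Longrightarrow>
      Lp_norm p (packet_sum {3..<3 + N} e w (\<lambda>k. axis i2 (real k)))
        \<le> ennreal (A * real N powr (if p = top then 0 else 1 / enn2real p))"
    using Lp_norm_translated_packets[OF p1] by blast
  \<comment> \<open>Translated packets with all coefficients 1.\<close>
  have "real N powr (1 / Q) \<le> (D * A) * real N powr (if p = top then 0 else 1 / enn2real p)" for N
    using key[of "\<lambda>_. 1" N "\<lambda>k. axis i2 (real k)"] upA[of "\<lambda>_. 1" N] D A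
    by (intro ennreal_powr_bound) auto
  then have PA: "1 / Q \<le> (if p = top then 0 else 1 / enn2real p)" by (rule powr_growth_exponent_le)
  \<comment> \<open>For infinite \<open>p\<close> the exponent on the right would be 0, which
    contradicts \<open>1 / Q > 0\<close>; a finite \<open>q\<close> therefore forces a finite
    \<open>p\<close>.\<close>
  then have ptop: "p \<noteq> top" using Q by auto
  define P where "P = enn2real p"
  have pP: "p = ennreal P" using ptop by (simp add: P_def less_top)
  have P: "1 < P" using \<open>1 < p\<close> unfolding pP by (simp add: ennreal_less_iff flip: ennreal_1)
  have "1 / Q \<le> 1 / P" using PA ptop by (simp add: P_def)
  then have "P \<le> Q" using P Q by (simp add: field_simps)
  then have "p \<le> q" unfolding pP qQ by (rule ennreal_leI)
  moreover have "2 \<le> q"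
  proof (cases "p < 2")
    case True
    obtain B where B: "B \<ge> 0"
      and upB: "\<And>N (w :: nat \<Rightarrow> real^'n). \<exists>e. (\<forall>k. cmod (e k) = 1) \<and>
        Lp_norm p (packet_sum {3..<3 + N} e w (\<lambda>k. 0)) \<le> ennreal (B * real N powr (1 / 2))"
      using Lp_norm_signed_packets[OF p1 True] by blast
    \<comment> \<open>Packets at the origin. The signs depend on \<open>N\<close> while
      \<open>D\<close> does not, which is why \<open>key\<close> has to be uniform in
      \<open>e\<close>.\<close>
    have "real N powr (1 / Q) \<le> (D * B) * real N powr (1 / 2)" for N
    proof -
      obtain e where e: "\<And>k. cmod (e k) = 1"
        "Lp_norm p (packet_sum {3..<3 + N} e (freq i1 i2 (3 + N)) (\<lambda>k. 0)) \<le> ennreal (B * real N powr (1 / 2))"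
        using upB by blast
      show ?thesis
        using key[of e N "\<lambda>k. 0", OF e(1)] e(2) D B by (intro ennreal_powr_bound) auto
    qed
    then have "1 / Q \<le> 1 / 2" by (rule powr_growth_exponent_le)
    then have "2 \<le> Q" using Q by (simp add: field_simps)
    then show ?thesis unfolding qQ by (simp flip: ennreal_numeral)
  next
    case False
    then show ?thesis using \<open>p \<le> q\<close> by simp
  qed
  ultimately show ?thesis by simp
qed simp

end
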